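(* Let $k>1$ be an integer and let $D>0$ be a non-square discriminant. Then for every $\tau\in\mathbb{H}\setminus E_D$, $$\xi_{2-2k}\left(\mathcal{F}_{1-k,D}\right)(\tau)=D^{\frac12-k}f_{k,D}(\tau),\qquad \mathcal{D}^{2k-1}\left(\mathcal{F}_{1-k,D}\right)(\tau)=-\frac{(2k-2)!}{(4\pi)^{2k-1}}D^{\frac12-k}f_{k,D}(\tau).$$
   Context: Write $\tau=x+iy\in\mathbb{H}$. A discriminant is an integer $\equiv0,1\pmod4$. $\mathcal{Q}_D$ is the set of $Q=[a,b,c]$, $Q(X,Y)=aX^2+bXY+cY^2$, $a,b,c\in\mathbb{Z}$, $b^2-4ac=D$. Let $\psi(v):=\frac12\int_0^v u^{k-\frac32}(1-u)^{-\frac12}du$ for $0\le v\le1$. Define $$\mathcal{F}_{1-k,D}(\tau):=\frac{D^{\frac12-k}}{\binom{2k-2}{k-1}\pi}\sum_{Q=[a,b,c]\in\mathcal{Q}_D}\operatorname{sgn}\left(a|\tau|^2+bx+c\right)Q(\tau,1)^{k-1}\psi\left(\frac{Dy^2}{|Q(\tau,1)|^2}\right)$$ ($\operatorname{sgn}(0)=0$) and $$f_{k,D}(\tau):=\frac{D^{k-\frac12}}{\binom{2k-2}{k-1}\pi}\sum_{[a,b,c]\in\mathcal{Q}_D}(a\tau^2+b\tau+c)^{-k}.$$ $E_D:=\{\tau\in\mathbb{H}:\exists [a,b,c]\in\mathcal{Q}_D,\ a|\tau|^2+bx+c=0\}$. The operators are $\xi_{2-2k}(F):=2iy^{2-2k}\overline{\frac{\partial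 F}{\partial\overline{\tau}}}$ and $\mathcal{D}:=\frac{1}{2\pi i}\frac{\partial}{\partial\tau}$. *)

theory Defs
  imports "HOL-Analysis.Analysis"
begin

definition upper_half_plane :: "complex set" where
  "upper_half_plane = {\<tau>. 0 < Im \<tau>}"

definition discriminant :: "int \<Rightarrow> bool" where
  "discriminant D \<longleftrightarrow> D mod 4 = 0 \<or> D mod 4 = 1"

text \<open>The form $[a,b,c]$ is represented by the triple \<open>(a, b, c)\<close> of its coefficients.\<close>

definition forms_disc :: "int \<Rightarrow> (int \<times> int \<times> int) set" where
  "forms_disc D = {(a, b, c). b^2 - 4 * a * c = D}"

definition form_eval :: "int \<times> int \<times> int \<Rightarrow> complex \<Rightarrow> complex \<Rightarrow> complex" where
  "form_eval = (\<lambda>(a, b, c) X Y. of_int a * X^2 + of_int b * X * Y + of_int c * Y^2)"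

text \<open>The real number $a|\tau|^2 + bx + c$, whose zero set in the upper half-plane is the
  geodesic attached to $[a,b,c]$.\<close>

definition geodesic_fun :: "int \<times> int \<times> int \<Rightarrow> complex \<Rightarrow> real" where
  "geodesic_fun = (\<lambda>(a, b, c) \<tau>. of_int a * (cmod \<tau>)^2 + of_int b * Re \<tau> + of_int c)"

definition exceptional_set :: "int \<Rightarrow> complex set" where
  "exceptional_set D = {\<tau> \<in> upper_half_plane. \<exists>Q \<in> forms_disc D. geodesic_fun Q \<tau> = 0}"

text \<open>For $v = 1$ the integrand is singular at $u = 1$, where \<open>0 powr (-1/2) = 0\<close>; this
  single value does not affect the integral.\<close>

definition psi :: "nat \<Rightarrow> real \<Rightarrow> real" where
  "psi k v = 1/2 * integral {0..v} (\<lambda>u. u powr (real k - 3/2) * (1 - u) powr (-1/2))"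

definition F_term :: "nat \<Rightarrow> int \<Rightarrow> complex \<Rightarrow> int \<times> int \<times> int \<Rightarrow> complex" where
  "F_term k D \<tau> Q =
     of_real (sgn (geodesic_fun Q \<tau>)) * form_eval Q \<tau> 1 ^ (k - 1) *
     of_real (psi k (of_int D * (Im \<tau>)^2 / (cmod (form_eval Q \<tau> 1))^2))"

definition F_series :: "nat \<Rightarrow> int \<Rightarrow> complex \<Rightarrow> complex" where
  "F_series k D \<tau> =
     of_real (of_int D powr (1/2 - real k) / (real ((2*k - 2) choose (k - 1)) * pi)) *
     (\<Sum>\<^sub>\<infinity>Q\<in>forms_disc D. F_term k D \<tau> Q)"

definition f_term :: "nat \<Rightarrow> complex \<Rightarrow> int \<times> int \<times> int \<Rightarrow> complex" where
  "f_term k \<tau> Q = form_eval Q \<tau> 1 powi (- int k)"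

definition f_series :: "nat \<Rightarrow> int \<Rightarrow> complex \<Rightarrow> complex" where
  "f_series k D \<tau> =
     of_real (of_int D powr (real k - 1/2) / (real ((2*k - 2) choose (k - 1)) * pi)) *
     (\<Sum>\<^sub>\<infinity>Q\<in>forms_disc D. f_term k \<tau> Q)"

text \<open>The Wirtinger derivatives $\frac12(\partial_x \mp i\,\partial_y)$: the real derivative of
  \<open>F\<close> at \<open>\<tau>\<close> applied to \<open>1\<close> and \<open>\<i>\<close> gives the partial derivatives in $x$ and $y$. They are
  meaningful only where \<open>F differentiable (at \<tau>)\<close>, which for functions of type
  \<open>complex \<Rightarrow> complex\<close> is real differentiability.\<close>

definition wirtinger :: "(complex \<Rightarrow> complex) \<Rightarrow> complex \<Rightarrow> complex" where
  "wirtinger F \<tau> =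
     (frechet_derivative F (at \<tau>) 1 - \<i> * frechet_derivative F (at \<tau>) \<i>) / 2"

definition wirtinger_bar :: "(complex \<Rightarrow> complex) \<Rightarrow> complex \<Rightarrow> complex" where
  "wirtinger_bar F \<tau> =
     (frechet_derivative F (at \<tau>) 1 + \<i> * frechet_derivative F (at \<tau>) \<i>) / 2"

definition xi_op :: "int \<Rightarrow> (complex \<Rightarrow> complex) \<Rightarrow> complex \<Rightarrow> complex" where
  "xi_op \<kappa> F \<tau> = 2 * \<i> * of_real (Im \<tau> powi \<kappa>) * cnj (wirtinger_bar F \<tau>)"

definition D_op :: "(complex \<Rightarrow> complex) \<Rightarrow> complex \<Rightarrow> complex" where
  "D_op F \<tau> = 1 / (2 * of_real pi * \<i>) * wirtinger F \<tau>"

end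

theory Submission
  imports Defs "HOL-Complex_Analysis.Complex_Analysis"
begin

text \<open>
  Write \<open>q = Q(\<tau>, 1)\<close>, \<open>g = a|\<tau>|\<^sup>2 + b x + c\<close> and \<open>m = 2k - 2\<close>, so that \<open>|q|\<^sup>2 = g\<^sup>2 + D y\<^sup>2\<close>.
  Away from the geodesic \<open>g = 0\<close> the term \<open>h\<close> of \<open>Q\<close> in the first series has
  antiholomorphic derivative \<open>(\<i>/2) D powr (k - 1/2) y ^ m / cnj q ^ k\<close>, and
  \<open>q \<partial>h - (k - 1) q' h\<close> equals \<open>-(\<i>/2) D powr (k - 1/2) y ^ m / cnj q ^ (k - 1)\<close>.
  On a disc missing all geodesics, \<open>h\<close> is therefore a holomorphic function \<open>H\<close> plus a
  polynomial of degree \<open>m\<close> in \<open>\<tau>\<close> with antiholomorphic coefficients vanishing at the centre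
  \<open>\<tau>\<^sub>0\<close>, and \<open>m + 1\<close> derivatives in \<open>\<tau>\<close> leave only those of \<open>H\<close>. Treating \<open>\<tau>\<close> and its conjugate as
  independent variables turns the second equation into an ordinary differential equation
  \<open>q H' - (k - 1) q' H = A (\<tau> - cnj \<tau>\<^sub>0) ^ m\<close>; differentiating it \<open>m + 1\<close> times shows that \<open>q ^ k\<close> times
  the \<open>(m + 1)\<close>-st derivative of \<open>H\<close> is constant. The series may be differentiated termwise by
  the Weierstrass M-test, because \<open>|q| ^ (-k)\<close> is locally bounded by a multiple of \<open>1 / (1 + b\<^sup>2)\<close>,
  and the number of forms with a given \<open>b\<close> is bounded by a divisor function.
\<close>

section \<open>Wirtinger derivatives and polarization\<close>

text \<open>The M-test gives uniform convergence along the filter of finite subsets, and uniform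
  limits of holomorphic functions on an open set commute with complex differentiation.\<close>

lemma holomorphic_higher_deriv_infsum:
  fixes f :: "'q \<Rightarrow> complex \<Rightarrow> complex"
  assumes A: "open A"
    and hol: "\<And>Q. Q \<in> I \<Longrightarrow> f Q holomorphic_on A"
    and le: "\<And>Q z. Q \<in> I \<Longrightarrow> z \<in> A \<Longrightarrow> norm (f Q z) \<le> M Q"
    and M: "M summable_on I"
  shows "(\<lambda>z. \<Sum>\<^sub>\<infinity>Q\<in>I. f Q z) holomorphic_on A"
    and "z \<in> A \<Longrightarrow> ((\<lambda>Q. (deriv ^^ n) (f Q) z) has_sum
           (deriv ^^ n) (\<lambda>z. \<Sum>\<^sub>\<infinity>Q\<in>I. f Q z) z) I"
proof -
  have lim: "uniform_limit A (\<lambda>X z. \<Sum>Q\<in>X. f Q z) (\<lambda>z. \<Sum>\<^sub>\<infinity>Q\<in>I. f Q z) (finite_subsets_at_top I)"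
    by (rule Weierstrass_m_test_general[OF le M])
  have hol_sum: "\<forall>\<^sub>F X in finite_subsets_at_top I. (\<lambda>z. \<Sum>Q\<in>X. f Q z) holomorphic_on A"
    by (rule eventually_finite_subsets_at_top_weakI) (auto intro!: holomorphic_on_sum hol)
  show "(\<lambda>z. \<Sum>\<^sub>\<infinity>Q\<in>I. f Q z) holomorphic_on A"
  proof (subst holomorphic_on_open[OF A], intro ballI)
    fix x assume "x \<in> A"
    then obtain r where r: "r > 0" "cball x r \<subseteq> A"
      using A by (meson open_contains_cball)
    have "(\<lambda>z. \<Sum>\<^sub>\<infinity>Q\<in>I. f Q z) holomorphic_on ball x r"
    proof (rule holomorphic_uniform_limit)
      show "\<forall>\<^sub>F X in finite_subsets_at_top I. continuous_on (cball x r) (\<lambda>z. \<Sum>Q\<in>X. f Q z) \<and>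
              (\<lambda>z. \<Sum>Q\<in>X. f Q z) holomorphic_on ball x r"
        using hol_sum
        by eventually_elim
          (use r ball_subset_cball[of x r] in
            \<open>blast intro: holomorphic_on_imp_continuous_on holomorphic_on_subset\<close>)
      show "uniform_limit (cball x r) (\<lambda>X z. \<Sum>Q\<in>X. f Q z) (\<lambda>z. \<Sum>\<^sub>\<infinity>Q\<in>I. f Q z)
              (finite_subsets_at_top I)"
        by (rule uniform_limit_on_subset[OF lim r(2)])
    qed simp_all
    then show "\<exists>f'. ((\<lambda>z. \<Sum>\<^sub>\<infinity>Q\<in>I. f Q z) has_field_derivative f') (at x)"
      using r(1) holomorphic_derivI[of _ "ball x r" x] by auto
  qed
  have sum: "(deriv ^^ n) (\<lambda>z. \<Sum>Q\<in>X. f Q z) z = (\<Sum>Q\<in>X. (deriv ^^ n) (f Q) z)"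
    if "finite X" "X \<subseteq> I" "z \<in> A" for X z n
    using that(1,2)
  proof (induction X rule: finite_induct)
    case empty
    then show ?case by simp
  next
    case (insert x F)
    have "(deriv ^^ n) (\<lambda>z. f x z + (\<Sum>Q\<in>F. f Q z)) z
            = (deriv ^^ n) (f x) z + (deriv ^^ n) (\<lambda>z. \<Sum>Q\<in>F. f Q z) z"
      by (rule higher_deriv_add[OF _ _ A that(3)]) (use insert in \<open>auto intro!: holomorphic_on_sum hol\<close>)
    with insert show ?case by simp
  qed
  show "((\<lambda>Q. (deriv ^^ n) (f Q) z) has_sum (deriv ^^ n) (\<lambda>z. \<Sum>\<^sub>\<infinity>Q\<in>I. f Q z) z) I" if z: "z \<in> A"
    unfolding has_sum_def
  proof (rule Lim_transform_eventually)
    show "((\<lambda>X. (deriv ^^ n) (\<lambda>z. \<Sum>Q\<in>X. f Q z) z) \<longlongrightarrow> (deriv ^^ n) (\<lambda>z. \<Sum>\<^sub>\<infinity>Q\<in>I. f Q z) z)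
            (finite_subsets_at_top I)"
      by (rule higher_deriv_complex_uniform_limit[OF lim hol_sum _ A z]) simp
    show "\<forall>\<^sub>F X in finite_subsets_at_top I.
            (deriv ^^ n) (\<lambda>z. \<Sum>Q\<in>X. f Q z) z = (\<Sum>Q\<in>X. (deriv ^^ n) (f Q) z)"
      by (rule eventually_finite_subsets_at_top_weakI) (use sum z in auto)
  qed
qed

text \<open>A real-linear map \<open>a * t + b * cnj t\<close> takes the values a + b at 1 and \<i>
  (a - b) at \<i>, which return both coefficients.\<close>

lemma wirtinger_eqI:
  assumes "(F has_derivative (\<lambda>t. a * t + b * cnj t)) (at z)"
  shows "wirtinger F z = a" and "wirtinger_bar F z = b"
proof -
  have "frechet_derivative F (at z) = (\<lambda>t. a * t + b * cnj t)"
    using frechet_derivative_at[OF assms] by simp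
  then show "wirtinger F z = a" "wirtinger_bar F z = b"
    by (simp_all add: wirtinger_def wirtinger_bar_def algebra_simps)
qed

lemma has_derivative_cnj_field:
  assumes "(f has_field_derivative f') (at z)"
  shows "((\<lambda>z. cnj (f z)) has_derivative (\<lambda>t. cnj (f' * t))) (at z)"
  using bounded_linear.has_derivative[OF bounded_linear_cnj assms[unfolded has_field_derivative_def]] .

lemma has_derivative_sum_mult_cnj:
  fixes f g :: "'j \<Rightarrow> complex \<Rightarrow> complex"
  assumes "\<And>j. j \<in> J \<Longrightarrow> (f j has_field_derivative f' j) (at z)"
    and "\<And>j. j \<in> J \<Longrightarrow> (g j has_field_derivative g' j) (at z)"
  shows "((\<lambda>z. \<Sum>j\<in>J. f j z * cnj (g j z)) has_derivative
    (\<lambda>t. (\<Sum>j\<in>J. f' j * cnj (g j z)) * t + (\<Sum>j\<in>J. f j z * cnj (g' j)) * cnj t)) (at z)"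
proof -
  have "((\<lambda>z. \<Sum>j\<in>J. f j z * cnj (g j z)) has_derivative
      (\<lambda>t. \<Sum>j\<in>J. f j z * cnj (g' j * t) + f' j * t * cnj (g j z))) (at z)"
    by (intro has_derivative_sum has_derivative_mult has_derivative_cnj_field)
      (use assms in \<open>auto simp: has_field_derivative_def\<close>)
  then show ?thesis
    by (simp add: sum_distrib_left sum_distrib_right sum.distrib mult_ac add_ac)
qed

text \<open>The holomorphic factor contributes only to the coefficient of \<open>t\<close>, the
  conjugated one only to that of \<open>cnj t\<close>. The series and the differential equation
  below are brought into this shape.\<close>

lemma wirtinger_sum_mult_cnj:
  fixes f g :: "'j \<Rightarrow> complex \<Rightarrow> complex"
  assumes "open S" "z \<in> S"
    and "\<And>j. j \<in> J \<Longrightarrow> f j holomorphic_on S" "\<And>j. j \<in> J \<Longrightarrow> g j holomorphic_on S"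
    and "\<And>w. w \<in> S \<Longrightarrow> F w = (\<Sum>j\<in>J. f j w * cnj (g j w))"
  shows "F differentiable (at z)"
    and "wirtinger F z = (\<Sum>j\<in>J. deriv (f j) z * cnj (g j z))"
    and "wirtinger_bar F z = (\<Sum>j\<in>J. f j z * cnj (deriv (g j) z))"
proof -
  have *: "((\<lambda>z. \<Sum>j\<in>J. f j z * cnj (g j z)) has_derivative
    (\<lambda>t. (\<Sum>j\<in>J. deriv (f j) z * cnj (g j z)) * t + (\<Sum>j\<in>J. f j z * cnj (deriv (g j) z)) * cnj t)) (at z)"
    by (rule has_derivative_sum_mult_cnj) (use assms in \<open>auto intro: holomorphic_derivI\<close>)
  have "(F has_derivative
    (\<lambda>t. (\<Sum>j\<in>J. deriv (f j) z * cnj (g j z)) * t + (\<Sum>j\<in>J. f j z * cnj (deriv (g j) z)) * cnj t)) (at z)"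
    by (rule has_derivative_transform_within_open[OF * assms(1,2)]) (simp add: assms(5))
  then show "F differentiable (at z)"
    and "wirtinger F z = (\<Sum>j\<in>J. deriv (f j) z * cnj (g j z))"
    and "wirtinger_bar F z = (\<Sum>j\<in>J. f j z * cnj (deriv (g j) z))"
    using wirtinger_eqI by (auto simp: differentiable_def)
qed

text \<open>The antiholomorphic factors act as constants for \<open>D_op\<close>, so the shape
  persists under iteration. Where some \<open>g j\<close> vanishes, its product contributes nothing
  to any iterate.\<close>

lemma D_op_funpow_sum_mult_cnj:
  fixes f g :: "'j \<Rightarrow> complex \<Rightarrow> complex"
  assumes S: "open S"
    and f: "\<And>j. j \<in> J \<Longrightarrow> f j holomorphic_on S" and g: "\<And>j. j \<in> J \<Longrightarrow> g j holomorphic_on S"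
    and F: "\<And>w. w \<in> S \<Longrightarrow> F w = (\<Sum>j\<in>J. f j w * cnj (g j w))"
    and z: "z \<in> S"
  shows "(D_op ^^ n) F z = (1 / (2 * of_real pi * \<i>)) ^ n * (\<Sum>j\<in>J. (deriv ^^ n) (f j) z * cnj (g j z))"
    and "(D_op ^^ n) F differentiable (at z)"
proof -
  let ?c = "1 / (2 * of_real pi * \<i>)"
  have hol: "(\<lambda>w. ?c ^ n * (deriv ^^ n) (f j) w) holomorphic_on S" if "j \<in> J" for j n
    by (intro holomorphic_intros holomorphic_higher_deriv f that S)
  have eq: "(D_op ^^ n) F w = (\<Sum>j\<in>J. (?c ^ n * (deriv ^^ n) (f j) w) * cnj (g j w))" if "w \<in> S" for n w
    using that
  proof (induction n arbitrary: w)
    case 0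
    then show ?case by (simp add: F)
  next
    case (Suc n)
    have "wirtinger ((D_op ^^ n) F) w
        = (\<Sum>j\<in>J. deriv (\<lambda>w. ?c ^ n * (deriv ^^ n) (f j) w) w * cnj (g j w))"
      by (rule wirtinger_sum_mult_cnj(2)[OF S Suc.prems hol g Suc.IH])
    also have "\<dots> = (\<Sum>j\<in>J. ?c ^ n * (deriv ^^ Suc n) (f j) w * cnj (g j w))"
    proof (rule sum.cong)
      fix j assume j: "j \<in> J"
      have "(deriv ^^ n) (f j) field_differentiable at w"
        using holomorphic_higher_deriv[OF f[OF j] S, of n] S Suc.prems
        by (rule holomorphic_on_imp_differentiable_at)
      then show "deriv (\<lambda>w. ?c ^ n * (deriv ^^ n) (f j) w) w * cnj (g j w)
          = ?c ^ n * (deriv ^^ Suc n) (f j) w * cnj (g j w)"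
        by (simp add: deriv_cmult)
    qed simp
    finally have "?c * wirtinger ((D_op ^^ n) F) w
        = (\<Sum>j\<in>J. ?c ^ Suc n * (deriv ^^ Suc n) (f j) w * cnj (g j w))"
      by (simp add: sum_distrib_left mult_ac)
    then show ?case
      by (simp only: funpow.simps o_apply D_op_def[of "(D_op ^^ n) F" w])
  qed
  show "(D_op ^^ n) F z = ?c ^ n * (\<Sum>j\<in>J. (deriv ^^ n) (f j) z * cnj (g j z))"
    using eq[OF z] by (simp add: sum_distrib_left mult_ac)
  show "(D_op ^^ n) F differentiable (at z)"
    by (rule wirtinger_sum_mult_cnj(1)[OF S z hol g eq])
qed

text \<open>Repeated \<open>wirtinger\<close> differentiation of the zero function shows that, with
  the conjugated factors frozen at \<open>w\<close>, all derivatives in \<open>z\<close> vanish at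
  \<open>z = w\<close>. The identity theorem then frees \<open>z\<close>.\<close>

lemma sum_mult_cnj_polarization:
  fixes f g :: "'j \<Rightarrow> complex \<Rightarrow> complex"
  assumes S: "open S" "connected S"
    and f: "\<And>j. j \<in> J \<Longrightarrow> f j holomorphic_on S" and g: "\<And>j. j \<in> J \<Longrightarrow> g j holomorphic_on S"
    and zero: "\<And>w. w \<in> S \<Longrightarrow> (\<Sum>j\<in>J. f j w * cnj (g j w)) = 0"
    and "z \<in> S" "w \<in> S"
  shows "(\<Sum>j\<in>J. f j z * cnj (g j w)) = 0"
proof -
  have diag: "(\<Sum>j\<in>J. (deriv ^^ n) (f j) z * cnj (g j z)) = 0" if "z \<in> S" for n z
    using that
  proof (induction n arbitrary: z)
    case 0
    then show ?case by (simp add: zero)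
  next
    case (Suc n)
    have "wirtinger (\<lambda>_. 0) z = (\<Sum>j\<in>J. deriv ((deriv ^^ n) (f j)) z * cnj (g j z))"
      by (rule wirtinger_sum_mult_cnj(2)[OF S(1) Suc.prems _ g])
        (use f S Suc.IH in \<open>auto intro: holomorphic_higher_deriv\<close>)
    moreover have "wirtinger (\<lambda>_. 0) z = 0"
      by (rule wirtinger_eqI(1)[of _ 0 0]) simp
    ultimately show ?case by simp
  qed
  have deriv_sum: "(deriv ^^ n) (\<lambda>z. \<Sum>j\<in>J. f j z * cnj (g j w)) z
      = (\<Sum>j\<in>J. (deriv ^^ n) (f j) z * cnj (g j w))" if "z \<in> S" for n z
    using that
  proof (induction n arbitrary: z)
    case 0
    then show ?case by simp
  next
    case (Suc n)
    have "((\<lambda>z. \<Sum>j\<in>J. (deriv ^^ n) (f j) z * cnj (g j w)) has_field_derivative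
        (\<Sum>j\<in>J. (deriv ^^ Suc n) (f j) z * cnj (g j w))) (at z)"
    proof (intro DERIV_sum DERIV_cmult_right)
      fix j assume "j \<in> J"
      then show "((deriv ^^ n) (f j) has_field_derivative (deriv ^^ Suc n) (f j) z) (at z)"
        using holomorphic_derivI[OF holomorphic_higher_deriv[OF f S(1), of j n] S(1) Suc.prems] by simp
    qed
    then have "((deriv ^^ n) (\<lambda>z. \<Sum>j\<in>J. f j z * cnj (g j w)) has_field_derivative
        (\<Sum>j\<in>J. (deriv ^^ Suc n) (f j) z * cnj (g j w))) (at z)"
      by (rule has_field_derivative_transform_within_open[OF _ S(1) Suc.prems]) (simp add: Suc.IH)
    then show ?case by (simp add: DERIV_imp_deriv)
  qed
  show ?thesis
  proof (rule holomorphic_fun_eq_0_on_connected[OF _ S _ \<open>w \<in> S\<close> \<open>z \<in> S\<close>, where f = "\<lambda>z. \<Sum>j\<in>J. f j z * cnj (g j w)"])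
    show "(\<lambda>z. \<Sum>j\<in>J. f j z * cnj (g j w)) holomorphic_on S"
      by (intro holomorphic_intros f)
    show "(deriv ^^ n) (\<lambda>z. \<Sum>j\<in>J. f j z * cnj (g j w)) w = 0" for n
      using deriv_sum[OF \<open>w \<in> S\<close>] diag[OF \<open>w \<in> S\<close>] by simp
  qed
qed

section \<open>A first-order differential equation with quadratic coefficients\<close>

text \<open>The degree is at most 2 n. These powers solve the homogeneous equation q p' = n q' p, so
  the ambiguity in its inhomogeneous solutions disappears after 2 n + 1 derivatives.\<close>

lemma higher_deriv_quadratic_power:
  fixes a b c :: complex
  shows "(deriv ^^ (2 * n + 1)) (\<lambda>z. (a * z^2 + b * z + c) ^ n) z = 0"
proof -
  have deriv_poly: "(deriv ^^ m) (poly P) = poly ((pderiv ^^ m) P)" for m and P :: "complex poly"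
  proof (induction m)
    case (Suc m)
    have "deriv (poly Q) = poly (pderiv Q)" for Q :: "complex poly"
      by (intro ext DERIV_imp_deriv poly_DERIV)
    with Suc show ?case by simp
  qed simp
  define P where "P = [:c, b, a:] ^ n"
  have "degree P \<le> degree [:c, b, a:] * n"
    unfolding P_def by (rule degree_power_le)
  also have "\<dots> \<le> 2 * n"
    by (intro mult_right_mono) auto
  finally have "degree P < i + (2 * n + 1)" for i by simp
  then have "(pderiv ^^ (2 * n + 1)) P = 0"
    by (intro poly_eqI) (simp add: coeff_higher_pderiv coeff_eq_0 del: funpow.simps)
  moreover have "(\<lambda>z. (a * z^2 + b * z + c) ^ n) = poly P"
    by (auto simp: P_def poly_power power2_eq_square algebra_simps)
  ultimately show ?thesis by (simp only: deriv_poly) simp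
qed

text \<open>In Leibniz' rule only three terms survive for a quadratic coefficient. The last one
  drops out when n = 2 \<kappa> + 1, and its factor n makes the truncated index \<open>n - 1\<close>
  harmless at n = 0.\<close>

lemma higher_deriv_quadratic_ode:
  fixes a b c \<kappa> :: complex
  assumes S: "open S" and p: "p holomorphic_on S" and R: "R holomorphic_on S"
    and ode: "\<And>z. z \<in> S \<Longrightarrow> (a * z^2 + b * z + c) * deriv p z - \<kappa> * (2 * a * z + b) * p z = R z"
    and "z \<in> S"
  shows "(a * z^2 + b * z + c) * (deriv ^^ Suc n) p z
     + (of_nat n - \<kappa>) * (2 * a * z + b) * (deriv ^^ n) p z
     + of_nat n * (of_nat n - 1 - 2 * \<kappa>) * a * (deriv ^^ (n - 1)) p z = (deriv ^^ n) R z"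
  using \<open>z \<in> S\<close>
proof (induction n arbitrary: z)
  case 0
  then show ?case using ode[of z] by (simp add: algebra_simps)
next
  case (Suc n)
  note z = Suc.prems
  have D: "((deriv ^^ m) f has_field_derivative (deriv ^^ Suc m) f z) (at z)"
    if "f holomorphic_on S" for f m
    using holomorphic_derivI[OF holomorphic_higher_deriv[OF that S, of m] S z] by simp
  have D3: "((\<lambda>z. of_nat n * (of_nat n - 1 - 2 * \<kappa>) * a * (deriv ^^ (n - 1)) p z) has_field_derivative
      of_nat n * (of_nat n - 1 - 2 * \<kappa>) * a * (deriv ^^ n) p z) (at z)"
  proof (cases n)
    case (Suc m)
    then show ?thesis using DERIV_cmult[OF D[OF p, of m]] by simp
  qed simp
  have "((\<lambda>z. (a * z^2 + b * z + c) * (deriv ^^ Suc n) p z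
     + (of_nat n - \<kappa>) * (2 * a * z + b) * (deriv ^^ n) p z
     + of_nat n * (of_nat n - 1 - 2 * \<kappa>) * a * (deriv ^^ (n - 1)) p z) has_field_derivative
      ((2 * a * z + b) * (deriv ^^ Suc n) p z + (a * z^2 + b * z + c) * (deriv ^^ Suc (Suc n)) p z
       + ((of_nat n - \<kappa>) * (2 * a) * (deriv ^^ n) p z
           + (of_nat n - \<kappa>) * (2 * a * z + b) * (deriv ^^ Suc n) p z)
       + of_nat n * (of_nat n - 1 - 2 * \<kappa>) * a * (deriv ^^ n) p z)) (at z)"
    by (rule derivative_eq_intros D[OF p] D3 refl | simp)+
  then have "((deriv ^^ n) R has_field_derivative
      ((2 * a * z + b) * (deriv ^^ Suc n) p z + (a * z^2 + b * z + c) * (deriv ^^ Suc (Suc n)) p z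
       + ((of_nat n - \<kappa>) * (2 * a) * (deriv ^^ n) p z
           + (of_nat n - \<kappa>) * (2 * a * z + b) * (deriv ^^ Suc n) p z)
       + of_nat n * (of_nat n - 1 - 2 * \<kappa>) * a * (deriv ^^ n) p z)) (at z)"
    by (rule has_field_derivative_transform_within_open[OF _ S z]) (rule Suc.IH)
  from DERIV_unique[OF this D[OF R]] show ?case
    by (simp add: algebra_simps)
qed

text \<open>After 2 l + 1 derivatives the right-hand side, of degree 2 l, is gone, and so is the
  lowest-order term of the recursion. What remains says exactly that the product has derivative
  0.\<close>

lemma higher_deriv_quadratic_ode_constant:
  fixes a b c A s :: complex
  assumes S: "open S" "connected S" and p: "p holomorphic_on S"
    and ode: "\<And>z. z \<in> S \<Longrightarrow>
      (a * z^2 + b * z + c) * deriv p z - of_nat l * (2 * a * z + b) * p z = A * (z - s) ^ (2 * l)"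
  shows "(\<lambda>z. (a * z^2 + b * z + c) ^ (l + 1) * (deriv ^^ (2 * l + 1)) p z) constant_on S"
proof (rule has_field_derivative_0_imp_constant_on[OF _ S(2,1)])
  fix z assume z: "z \<in> S"
  let ?p = "\<lambda>n. (deriv ^^ n) p z"
  have "(\<lambda>w. (w - s) ^ (2 * l)) holomorphic_on UNIV" by (intro holomorphic_intros)
  then have "(deriv ^^ (2 * l + 1)) (\<lambda>z. A * (z - s) ^ (2 * l)) z = 0"
    using higher_deriv_power[of "2 * l + 1" s "2 * l" z] higher_deriv_cmult[of _ UNIV z "2 * l + 1" A]
    by (simp add: pochhammer_0_left)
  moreover have "(a * z^2 + b * z + c) * ?p (Suc (2 * l + 1))
     + (of_nat (2 * l + 1) - of_nat l) * (2 * a * z + b) * ?p (2 * l + 1)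
     + of_nat (2 * l + 1) * (of_nat (2 * l + 1) - 1 - 2 * of_nat l) * a * ?p (2 * l + 1 - 1)
     = (deriv ^^ (2 * l + 1)) (\<lambda>z. A * (z - s) ^ (2 * l)) z"
    by (rule higher_deriv_quadratic_ode[OF S(1) p _ ode z]) (intro holomorphic_intros)
  ultimately have eq: "(a * z^2 + b * z + c) * ?p (Suc (2 * l + 1))
     + (of_nat l + 1) * (2 * a * z + b) * ?p (2 * l + 1) = 0"
    by (simp del: funpow.simps)
  have "((deriv ^^ (2 * l + 1)) p has_field_derivative ?p (Suc (2 * l + 1))) (at z)"
    using holomorphic_derivI[OF holomorphic_higher_deriv[OF p S(1), of "2 * l + 1"] S(1) z] by simp
  then have "((\<lambda>z. (a * z^2 + b * z + c) ^ (l + 1) * (deriv ^^ (2 * l + 1)) p z) has_field_derivative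
      (of_nat (l + 1) * (a * z^2 + b * z + c) ^ l * (2 * a * z + b) * ?p (2 * l + 1)
        + (a * z^2 + b * z + c) ^ (l + 1) * ?p (Suc (2 * l + 1)))) (at z)"
    by - (rule derivative_eq_intros refl | assumption | simp del: funpow.simps)+
  also have "of_nat (l + 1) * (a * z^2 + b * z + c) ^ l * (2 * a * z + b) * ?p (2 * l + 1)
        + (a * z^2 + b * z + c) ^ (l + 1) * ?p (Suc (2 * l + 1))
      = (a * z^2 + b * z + c) ^ l * ((a * z^2 + b * z + c) * ?p (Suc (2 * l + 1))
     + (of_nat l + 1) * (2 * a * z + b) * ?p (2 * l + 1))"
    by (simp add: algebra_simps del: funpow.simps)
  also have "\<dots> = 0" using eq by simp
  finally show "((\<lambda>z. (a * z^2 + b * z + c) ^ (l + 1) * (deriv ^^ (2 * l + 1)) p z)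
      has_field_derivative 0) (at z)" .
qed

text \<open>Positive discriminant puts both roots on the real axis, symmetric about
  \<open>- b / (2 * a)\<close>. \<open>U\<close> is the plane without the two real rays running
  outwards from the roots: it joins the half planes through the gap between the roots and is
  starlike about their midpoint.\<close>

lemma quadratic_slit_plane:
  fixes a b c :: real
  assumes "a \<noteq> 0" "b^2 - 4 * a * c > 0"
  defines "U \<equiv> {z. Im z \<noteq> 0 \<or> \<bar>Re z - (- b / (2 * a))\<bar> < sqrt (b^2 - 4 * a * c) / (2 * \<bar>a\<bar>)}"
  shows "open U" and "starlike U"
    and "\<And>z. z \<in> U \<Longrightarrow> of_real a * z^2 + of_real b * z + of_real c \<noteq> 0"
proof -
  define m where "m = - b / (2 * a)"
  define \<rho> where "\<rho> = sqrt (b^2 - 4 * a * c) / (2 * \<bar>a\<bar>)"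
  have U: "U = {z. Im z \<noteq> 0} \<union> {z. \<bar>Re z - m\<bar> < \<rho>}"
    by (auto simp: U_def m_def \<rho>_def)
  have \<rho>: "\<rho> > 0" using assms by (simp add: \<rho>_def)
  show "open U" unfolding U
    by (intro open_Un open_Collect_neq open_Collect_less continuous_intros)
  have "closed_segment (of_real m) z \<subseteq> U" if z: "z \<in> U" for z
  proof
    fix w assume "w \<in> closed_segment (of_real m) z"
    then obtain u where u: "0 \<le> u" "u \<le> 1" "w = (1 - u) *\<^sub>R of_real m + u *\<^sub>R z"
      by (auto simp: in_segment)
    have w: "Im w = u * Im z" "Re w - m = u * (Re z - m)"
      by (simp_all add: u algebra_simps)
    show "w \<in> U"
    proof (cases "u = 0 \<or> Im z = 0")
      case False
      then show ?thesis by (simp add: U w)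
    next
      case True
      have "\<bar>Re w - m\<bar> < \<rho>"
      proof (cases "u = 0")
        case False
        with True z have "\<bar>Re z - m\<bar> < \<rho>" by (simp add: U)
        moreover have "\<bar>Re w - m\<bar> \<le> \<bar>Re z - m\<bar>"
          unfolding w(2) abs_mult using u(1,2) by (simp add: mult_left_le_one_le)
        ultimately show ?thesis by simp
      qed (use w \<rho> in simp)
      then show ?thesis by (simp add: U)
    qed
  qed
  moreover have "of_real m \<in> U" using \<rho> by (simp add: U)
  ultimately show "starlike U" by (auto simp: starlike_def)
  fix z assume z: "z \<in> U"
  show "of_real a * z^2 + of_real b * z + of_real c \<noteq> 0"
  proof
    assume eq: "of_real a * z^2 + of_real b * z + of_real c = 0"
    \<comment> \<open>Completing the square: at a root, 2 a z + b is a square root of a positive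
      number and hence real.\<close>
    have "(of_real (2 * a) * z + of_real b)^2 - of_real (b^2 - 4 * a * c)
        = 4 * of_real a * (of_real a * z^2 + of_real b * z + of_real c)"
      by (simp add: power2_eq_square algebra_simps)
    with eq have sq: "(of_real (2 * a) * z + of_real b)^2 = complex_of_real (b^2 - 4 * a * c)" by simp
    have re: "(2 * a * Re z + b)^2 - (2 * a * Im z)^2 = b^2 - 4 * a * c"
      using arg_cong[OF sq, of Re] by (simp add: power2_eq_square)
    have im: "(2 * a * Re z + b) * (2 * a * Im z) = 0"
      using arg_cong[OF sq, of Im] by (auto simp: power2_eq_square)
    have "Im z = 0"
    proof (rule ccontr)
      assume "Im z \<noteq> 0"
      with im assms have "2 * a * Re z + b = 0" by simp
      with re have "b^2 - 4 * a * c = - ((2 * a * Im z)^2)" by simp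
      also have "\<dots> \<le> 0" by simp
      finally show False using assms by simp
    qed
    with re have "\<bar>2 * a * Re z + b\<bar> = sqrt (b^2 - 4 * a * c)"
      by (metis cancel_comm_monoid_add_class.diff_zero mult_zero_right power_zero_numeral real_sqrt_abs)
    moreover have "Re z - m = (2 * a * Re z + b) / (2 * a)"
      using assms by (simp add: m_def field_simps)
    then have "\<bar>Re z - m\<bar> = \<bar>2 * a * Re z + b\<bar> / (2 * \<bar>a\<bar>)"
      by (simp add: abs_mult)
    ultimately show False using z \<open>Im z = 0\<close> by (simp add: U \<rho>_def)
  qed
qed

text \<open>The solution is continued along the slit plane to the point \<open>s\<close>, where the right-hand side
  vanishes to order \<open>2 * l\<close>, so that the constant value of
  \<open>q ^ (l + 1) * (deriv ^^ (2 * l + 1)) p\<close> can be read off.\<close>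

lemma quadratic_ode_higher_deriv:
  fixes a b c :: real and \<tau> s A :: complex
  defines "q \<equiv> \<lambda>z. of_real a * z^2 + of_real b * z + of_real c"
  assumes abc: "a \<noteq> 0" "b^2 - 4 * a * c > 0" and im: "Im \<tau> \<noteq> 0" "Im s \<noteq> 0"
    and r: "r > 0" and p: "p holomorphic_on ball \<tau> r"
    and ode: "\<And>z. z \<in> ball \<tau> r \<Longrightarrow>
      q z * deriv p z - of_nat l * (2 * of_real a * z + of_real b) * p z = A * (z - s) ^ (2 * l)"
  shows "(deriv ^^ (2 * l + 1)) p \<tau> = A * fact (2 * l) * q s ^ l / q \<tau> ^ (l + 1)"
proof -
  define U where "U = {z. Im z \<noteq> 0 \<or> \<bar>Re z - (- b / (2 * a))\<bar> < sqrt (b^2 - 4 * a * c) / (2 * \<bar>a\<bar>)}"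
  have U: "open U" "starlike U" and qnz: "\<And>z. z \<in> U \<Longrightarrow> q z \<noteq> 0"
    using quadratic_slit_plane[OF abc] unfolding U_def q_def by blast+
  have conn: "connected U" by (rule starlike_imp_connected[OF U(2)])
  have sU: "s \<in> U" and tU: "\<tau> \<in> U" using im by (auto simp: U_def)
  define q' where "q' = (\<lambda>z::complex. 2 * of_real a * z + of_real b)"
  have dq: "(q has_field_derivative q' z) (at z)" for z
    unfolding q_def q'_def by (rule derivative_eq_intros refl | simp)+
  have qhol: "q holomorphic_on X" for X
    unfolding q_def by (intro holomorphic_intros)
  have "(\<lambda>z. (z - s) ^ (2 * l) / q z ^ (l + 1)) holomorphic_on U"
    using qnz by (intro holomorphic_intros qhol) auto
  then obtain G0 where G0: "\<And>z. z \<in> U \<Longrightarrow> (G0 has_field_derivative (z - s) ^ (2 * l) / q z ^ (l + 1)) (at z)"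
    using holomorphic_starlike_primitive[OF _ U(2,1) finite.emptyI, of "\<lambda>z. (z - s) ^ (2 * l) / q z ^ (l + 1)"]
      U(1) by (auto simp: holomorphic_on_imp_continuous_on holomorphic_on_imp_differentiable_at)
  \<comment> \<open>Variation of constants: \<open>q ^ l\<close> solves the homogeneous equation,
    and the primitive is normalised so that \<open>p1\<close> vanishes at \<open>s\<close>.\<close>
  define p1 where "p1 = (\<lambda>z. A * (q z ^ l * (G0 z - G0 s)))"
  have p1': "(p1 has_field_derivative
      A * (of_nat l * q z ^ (l - 1) * q' z * (G0 z - G0 s) + q z ^ l * ((z - s) ^ (2 * l) / q z ^ (l + 1)))) (at z)"
    if "z \<in> U" for z
    unfolding p1_def by (rule derivative_eq_intros dq G0[OF that] refl | simp)+
  have p1hol: "p1 holomorphic_on U"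
    using p1' U(1) by (auto simp: holomorphic_on_open)
  have ode1: "q z * deriv p1 z - of_nat l * q' z * p1 z = A * (z - s) ^ (2 * l)" if "z \<in> U" for z
  proof -
    define X where "X = of_nat l * q z ^ (l - 1) * q' z * (G0 z - G0 s)"
    define Y where "Y = q z ^ l * ((z - s) ^ (2 * l) / q z ^ (l + 1))"
    have "deriv p1 z = A * (X + Y)"
      unfolding X_def Y_def by (rule DERIV_imp_deriv[OF p1'[OF that]])
    then have "q z * deriv p1 z = A * (q z * X) + A * (q z * Y)"
      by (simp add: algebra_simps)
    also have "q z * X = of_nat l * q' z * (q z ^ l * (G0 z - G0 s))"
      unfolding X_def by (cases l) (simp_all add: mult_ac)
    also have "q z * Y = (z - s) ^ (2 * l)"
      unfolding Y_def using qnz[OF that] by (simp add: field_simps)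
    also have "A * (of_nat l * q' z * (q z ^ l * (G0 z - G0 s))) = of_nat l * q' z * p1 z"
      by (simp add: p1_def mult_ac)
    finally show ?thesis by simp
  qed
  have rec: "q z * (deriv ^^ Suc n) p1 z + (of_nat n - of_nat l) * q' z * (deriv ^^ n) p1 z
     + of_nat n * (of_nat n - 1 - 2 * of_nat l) * of_real a * (deriv ^^ (n - 1)) p1 z
     = (deriv ^^ n) (\<lambda>z. A * (z - s) ^ (2 * l)) z" if "z \<in> U" for n z
    unfolding q_def q'_def
    by (rule higher_deriv_quadratic_ode[OF U(1) p1hol])
      (use ode1 that in \<open>auto simp: q_def q'_def intro!: holomorphic_intros\<close>)
  have rhs: "(deriv ^^ n) (\<lambda>z. A * (z - s) ^ (2 * l)) s
      = A * (pochhammer (of_nat (Suc (2 * l) - n)) n * 0 ^ (2 * l - n))" for n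
  proof -
    have "(\<lambda>w. (w - s) ^ (2 * l)) holomorphic_on UNIV" by (intro holomorphic_intros)
    then show ?thesis
      using higher_deriv_power[of n s "2 * l" s] higher_deriv_cmult[of _ UNIV s n A] by simp
  qed
  \<comment> \<open>The recursion at \<open>s\<close> is solved for its highest derivative; below
    order \<open>2 * l\<close> the right-hand side still contains a factor z - s. At order
    \<open>2 * l\<close> it equals \<open>A * fact (2 * l)\<close>, which fixes the next
    derivative.\<close>
  have vanish: "\<forall>j\<le>n. (deriv ^^ j) p1 s = 0" if "n \<le> 2 * l" for n
    using that
  proof (induction n)
    case 0
    then show ?case by (simp add: p1_def)
  next
    case (Suc n)
    then have "(deriv ^^ n) p1 s = 0" "(deriv ^^ (n - 1)) p1 s = 0" by auto
    then have "q s * (deriv ^^ Suc n) p1 s = 0"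
      using rec[OF sU, of n] rhs[of n] Suc.prems by (simp del: funpow.simps)
    then have "(deriv ^^ Suc n) p1 s = 0" using qnz[OF sU] by simp
    with Suc show ?case by (auto simp: le_Suc_eq simp del: funpow.simps)
  qed
  have "(deriv ^^ (2 * l)) p1 s = 0" "(deriv ^^ (2 * l - 1)) p1 s = 0"
    using vanish[of "2 * l"] by auto
  then have "q s * (deriv ^^ (2 * l + 1)) p1 s = A * fact (2 * l)"
    using rec[OF sU, of "2 * l"] rhs[of "2 * l"] by (simp add: pochhammer_fact del: funpow.simps)
  \<comment> \<open>The conserved quantity carries the value from \<open>s\<close> to \<tau> through
    the connected slit plane, even between opposite half planes.\<close>
  moreover have "(\<lambda>z. q z ^ (l + 1) * (deriv ^^ (2 * l + 1)) p1 z) constant_on U"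
    unfolding q_def
    by (rule higher_deriv_quadratic_ode_constant[OF U(1) conn p1hol])
      (use ode1 in \<open>auto simp: q_def q'_def\<close>)
  then have "q \<tau> ^ (l + 1) * (deriv ^^ (2 * l + 1)) p1 \<tau> = q s ^ (l + 1) * (deriv ^^ (2 * l + 1)) p1 s"
    using sU tU unfolding constant_on_def by metis
  ultimately have "q \<tau> ^ (l + 1) * (deriv ^^ (2 * l + 1)) p1 \<tau> = A * fact (2 * l) * q s ^ l"
    by (simp add: mult_ac del: funpow.simps)
  then have val: "(deriv ^^ (2 * l + 1)) p1 \<tau> = A * fact (2 * l) * q s ^ l / q \<tau> ^ (l + 1)"
    using qnz[OF tU] by (simp add: eq_divide_eq mult.commute del: funpow.simps power_Suc)
  obtain e where e: "e > 0" "ball \<tau> e \<subseteq> U \<inter> ball \<tau> r"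
    using U(1) tU r openE[of "U \<inter> ball \<tau> r" \<tau>] by (metis IntI centre_in_ball open_Int open_ball)
  \<comment> \<open>Two solutions of the inhomogeneous equation differ by a multiple of
    \<open>q ^ l\<close>, which \<open>2 * l + 1\<close> derivatives annihilate, so \<open>p\<close>
    inherits the value found for \<open>p1\<close>.\<close>
  have "((\<lambda>z. (p z - p1 z) * inverse (q z) ^ l) has_field_derivative 0) (at z)" if z: "z \<in> ball \<tau> e" for z
  proof -
    have zU: "z \<in> U" and zr: "z \<in> ball \<tau> r" using z e by auto
    have dp: "(p has_field_derivative deriv p z) (at z)"
      using holomorphic_derivI[OF p _ zr] by simp
    have dp1: "(p1 has_field_derivative deriv p1 z) (at z)"
      using holomorphic_derivI[OF p1hol U(1) zU] .
    have *: "((\<lambda>z. (p z - p1 z) * inverse (q z) ^ l) has_field_derivative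
      ((deriv p z - deriv p1 z) * inverse (q z) ^ l
        + (p z - p1 z) * (of_nat l * inverse (q z) ^ (l - 1) * - (inverse (q z) * q' z * inverse (q z))))) (at z)"
      by (rule derivative_eq_intros dp dp1 dq refl qnz[OF zU] | simp)+
    have 1: "of_nat l * inverse (q z) ^ (l - 1) * (inverse (q z) * q' z * inverse (q z))
        = of_nat l * q' z * inverse (q z) ^ (l + 1)" by (cases l) auto
    have 2: "inverse (q z) ^ l = q z * inverse (q z) ^ (l + 1)" using qnz[OF zU] by simp
    have "(deriv p z - deriv p1 z) * inverse (q z) ^ l
        + (p z - p1 z) * (of_nat l * inverse (q z) ^ (l - 1) * - (inverse (q z) * q' z * inverse (q z)))
        = inverse (q z) ^ (l + 1) *
          ((q z * deriv p z - of_nat l * q' z * p z) - (q z * deriv p1 z - of_nat l * q' z * p1 z))"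
      unfolding mult_minus_right 1 2 by (simp add: algebra_simps)
    also have "\<dots> = 0"
      using ode[OF zr] ode1[OF zU] by (simp add: q'_def)
    finally show ?thesis using * by simp
  qed
  then have "(\<lambda>z. (p z - p1 z) * inverse (q z) ^ l) constant_on ball \<tau> e"
    by (rule has_field_derivative_0_imp_constant_on) auto
  then obtain K where K: "\<And>z. z \<in> ball \<tau> e \<Longrightarrow> (p z - p1 z) * inverse (q z) ^ l = K"
    unfolding constant_on_def by blast
  have p_eq: "p z = p1 z + K * q z ^ l" if "z \<in> ball \<tau> e" for z
  proof -
    have "q z \<noteq> 0" using e that qnz by auto
    then show ?thesis using K[OF that] by (auto simp: power_inverse field_simps)
  qed
  have te: "\<tau> \<in> ball \<tau> e" using e by simp
  have h1: "p1 holomorphic_on ball \<tau> e" and h2: "p holomorphic_on ball \<tau> e"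
    using p1hol p e by (auto intro: holomorphic_on_subset)
  have h3: "(\<lambda>z. q z ^ l) holomorphic_on ball \<tau> e" by (intro holomorphic_intros qhol)
  have h4: "(\<lambda>z. K * q z ^ l) holomorphic_on ball \<tau> e" by (intro holomorphic_intros qhol)
  have "(deriv ^^ (2 * l + 1)) p \<tau> = (deriv ^^ (2 * l + 1)) (\<lambda>z. p1 z + K * q z ^ l) \<tau>"
    using p_eq by (intro higher_deriv_transform_within_open[OF h2 _ open_ball te] holomorphic_intros h1 qhol) auto
  also have "\<dots> = (deriv ^^ (2 * l + 1)) p1 \<tau> + (deriv ^^ (2 * l + 1)) (\<lambda>z. K * q z ^ l) \<tau>"
    by (rule higher_deriv_add[OF h1 h4 open_ball te])
  also have "(deriv ^^ (2 * l + 1)) (\<lambda>z. K * q z ^ l) \<tau> = K * (deriv ^^ (2 * l + 1)) (\<lambda>z. q z ^ l) \<tau>"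
    by (rule higher_deriv_cmult[OF h3 te open_ball])
  also have "(deriv ^^ (2 * l + 1)) (\<lambda>z. q z ^ l) \<tau> = 0"
    unfolding q_def by (rule higher_deriv_quadratic_power)
  finally show ?thesis using val by simp
qed

section \<open>Summation over forms of fixed discriminant\<close>

lemma card_divisors_mult_le:
  fixes m n :: nat
  assumes "m > 0" "n > 0"
  shows "card {d. d dvd m * n} \<le> card {d. d dvd m} * card {d. d dvd n}"
proof -
  have "{d. d dvd m * n} \<subseteq> (\<lambda>(a, b). a * b) ` ({d. d dvd m} \<times> {d. d dvd n})"
    by (force dest: division_decomp)
  moreover have fin: "finite {d. d dvd m}" "finite {d. d dvd n}"
    using assms by auto
  ultimately have "card {d. d dvd m * n} \<le> card ((\<lambda>(a, b). a * b) ` ({d. d dvd m} \<times> {d. d dvd n}))"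
    by (intro card_mono finite_imageI finite_cartesian_product)
  also have "\<dots> \<le> card ({d. d dvd m} \<times> {d. d dvd n})"
    using fin by (intro card_image_le finite_cartesian_product)
  finally show ?thesis by (simp add: card_cartesian_product)
qed

lemma card_divisors_prime_power_le:
  fixes p :: nat
  assumes "prime p"
  shows "card {d. d dvd p ^ e} \<le> e + 1"
proof -
  have "{d. d dvd p ^ e} \<subseteq> (\<lambda>i. p ^ i) ` {..e}"
    using assms by (auto simp: divides_primepow_nat)
  then have "card {d. d dvd p ^ e} \<le> card {..e}"
    by (meson card_image_le card_mono finite_atMost finite_imageI order_trans)
  then show ?thesis by simp
qed

text \<open>The factor lost for each prime below 8: the reciprocal of the slope in Bernoulli's
  inequality for powers of the cube root of 2.\<close>

definition cbrt_const :: real where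
  "cbrt_const = 1 / (2 powr (1/3) - 1)"

lemma cbrt_2_bounds: "2 powr (1/3) > (1::real)" "2 powr (1/3) \<le> (2::real)"
  using powr_mono[of "1/3" 1 "2::real"] by auto

lemma cbrt_const_ge_1: "cbrt_const \<ge> 1"
  using cbrt_2_bounds by (simp add: cbrt_const_def field_simps)

text \<open>For the cube root t of 2, Bernoulli gives t^e \<ge> 1 + e (t - 1), which is at least (e
  + 1) (t - 1) because t - 1 \<le> 1.\<close>

lemma Suc_le_cbrt_const:
  fixes p :: real
  assumes "p \<ge> 2"
  shows "real e + 1 \<le> cbrt_const * (p ^ e) powr (1/3)"
proof -
  define t :: real where "t = 2 powr (1/3)"
  have t: "t > 1" "t \<le> 2" using cbrt_2_bounds by (auto simp: t_def)
  have "1 + real e * (t - 1) \<le> t ^ e"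
    using Bernoulli_inequality[of "t - 1" e] t by simp
  moreover have "t - 1 \<le> 1" using t by simp
  ultimately have "(real e + 1) * (t - 1) \<le> t ^ e"
    by (simp add: algebra_simps)
  also have "t ^ e = (2 ^ e) powr (1/3)"
    by (simp add: t_def powr_powr mult.commute flip: powr_realpow)
  also have "\<dots> \<le> (p ^ e) powr (1/3)"
    using assms by (intro powr_mono2 power_mono) auto
  finally show ?thesis
    using t by (simp add: cbrt_const_def t_def[symmetric] field_simps)
qed

text \<open>From 8 on the cube root is at least 2, and 2^e \<ge> e + 1, so large primes cost no
  constant.\<close>

lemma Suc_le_cbrt:
  fixes p :: real
  assumes "p \<ge> 8"
  shows "real e + 1 \<le> (p ^ e) powr (1/3)"
proof -
  have "(8::real) ^ e = (2 ^ e) ^ 3"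
    using power_mult[of "2::real" 3 e] power_mult[of "2::real" e 3] by (simp add: mult.commute)
  then have 8: "(8 ^ e) powr (1/3 :: real) = 2 ^ e"
    using powr_powr[of "2 ^ e :: real" 3 "1/3"] by simp
  have "real e + 1 \<le> 2 ^ e"
    using Bernoulli_inequality[of "1::real" e] by simp
  also have "2 ^ e = (8 ^ e) powr (1/3 :: real)"
    by (simp add: 8)
  also have "\<dots> \<le> (p ^ e) powr (1/3)"
    using assms by (intro powr_mono2 power_mono) auto
  finally show ?thesis .
qed

text \<open>A prime power \<open>p ^ e\<close> contributes the factor \<open>e + 1\<close> to the number of divisors, which is at
  most \<open>p powr (e / 3)\<close> unless \<open>p < 8\<close>.\<close>

lemma card_divisors_le_aux:
  fixes n :: nat
  assumes "n > 0"
  shows "real (card {d. d dvd n})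
    \<le> cbrt_const ^ card {p. prime p \<and> p dvd n \<and> p < 8} * real n powr (1/3)"
  using assms
proof (induction n rule: less_induct)
  case (less n)
  show ?case
  proof (cases "n = 1")
    case True
    then show ?thesis using one_le_power[OF cbrt_const_ge_1] by simp
  next
    case False
    \<comment> \<open>The full power of one prime is stripped off. The small primes dividing the
      cofactor \<open>m\<close> are those of \<open>n\<close> other than \<open>p\<close>, so the
      exponent of \<open>cbrt_const\<close> grows by one exactly when \<open>p < 8\<close>.\<close>
    then obtain p where p: "prime p" "p dvd n"
      using prime_factor_nat by blast
    define e where "e = multiplicity p n"
    obtain m where n: "n = p ^ e * m" and pm: "\<not> p dvd m"
      using multiplicity_decompose'[of n p] less.prems p
      by (metis e_def not_prime_unit not_gr_zero)
    have e: "e > 0"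
      using p less.prems by (simp add: e_def prime_multiplicity_gt_zero_iff)
    have m: "m > 0" using less.prems n by (cases m) auto
    have "p ^ e > 1" using prime_gt_1_nat[OF p(1)] e by (rule one_less_power)
    then have mn: "m < n" using m by (simp add: n)
    have IH: "real (card {d. d dvd m})
        \<le> cbrt_const ^ card {q. prime q \<and> q dvd m \<and> q < 8} * real m powr (1/3)"
      by (rule less.IH[OF mn m])
    let ?w = "\<lambda>n. {q::nat. prime q \<and> q dvd n \<and> q < 8}"
    have fin: "finite (?w m)" by (rule finite_subset[of _ "{..<8}"]) auto
    have w: "?w n = (if p < 8 then insert p (?w m) else ?w m)"
      unfolding n using p(1) e
      by (auto simp: prime_dvd_mult_iff prime_dvd_power_iff dest: primes_dvd_imp_eq)
    have factor: "(real e + 1) * cbrt_const ^ card (?w m) \<le> cbrt_const ^ card (?w n) * (real p ^ e) powr (1/3)"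
    proof (cases "p < 8")
      case True
      have "card (?w n) = Suc (card (?w m))"
        using True w fin pm by simp
      moreover have "real e + 1 \<le> cbrt_const * (real p ^ e) powr (1/3)"
        using prime_ge_2_nat[OF p(1)] by (intro Suc_le_cbrt_const) simp
      then have "(real e + 1) * cbrt_const ^ card (?w m) \<le>
          (cbrt_const * (real p ^ e) powr (1/3)) * cbrt_const ^ card (?w m)"
        using cbrt_const_ge_1 by (intro mult_right_mono) auto
      ultimately show ?thesis by (simp add: mult_ac)
    next
      case False
      then have "real e + 1 \<le> (real p ^ e) powr (1/3)"
        by (intro Suc_le_cbrt) simp
      then have "(real e + 1) * cbrt_const ^ card (?w m) \<le>
          (real p ^ e) powr (1/3) * cbrt_const ^ card (?w m)"
        using cbrt_const_ge_1 by (intro mult_right_mono) auto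
      then show ?thesis using False w by (simp add: mult_ac)
    qed
    have "card {d. d dvd n} \<le> card {d. d dvd p ^ e} * card {d. d dvd m}"
      unfolding n using m prime_gt_0_nat[OF p(1)] by (intro card_divisors_mult_le) auto
    also have "\<dots> \<le> (e + 1) * card {d. d dvd m}"
      by (intro mult_right_mono card_divisors_prime_power_le p) simp
    finally have "real (card {d. d dvd n}) \<le> real ((e + 1) * card {d. d dvd m})"
      by (rule of_nat_mono)
    also have "\<dots> = (real e + 1) * real (card {d. d dvd m})"
      by (simp add: algebra_simps)
    also have "\<dots> \<le> (real e + 1) * (cbrt_const ^ card (?w m) * real m powr (1/3))"
      by (intro mult_left_mono IH) simp
    also have "\<dots> = (real e + 1) * cbrt_const ^ card (?w m) * real m powr (1/3)"
      by simp
    also have "\<dots> \<le> cbrt_const ^ card (?w n) * (real p ^ e) powr (1/3) * real m powr (1/3)"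
      by (intro mult_right_mono factor) simp
    also have "\<dots> = cbrt_const ^ card (?w n) * real n powr (1/3)"
      by (simp add: n powr_mult)
    finally show ?thesis .
  qed
qed

text \<open>At most 8 primes lie below 8, a crude count that makes the constant uniform in
  \<open>n\<close>. The exponent 1/3 is below 1/2, as convergence of the later sum over b
  requires.\<close>

lemma card_divisors_le:
  fixes n :: nat
  assumes "n > 0"
  shows "real (card {d. d dvd n}) \<le> cbrt_const ^ 8 * real n powr (1/3)"
proof -
  have "card {p::nat. prime p \<and> p dvd n \<and> p < 8} \<le> card {..<8::nat}"
    by (intro card_mono) auto
  then have "cbrt_const ^ card {p::nat. prime p \<and> p dvd n \<and> p < 8} \<le> cbrt_const ^ 8"
    using cbrt_const_ge_1 by (intro power_increasing) auto
  then have "cbrt_const ^ card {p::nat. prime p \<and> p dvd n \<and> p < 8} * real n powr (1/3)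
      \<le> cbrt_const ^ 8 * real n powr (1/3)"
    by (intro mult_right_mono) auto
  then show ?thesis using card_divisors_le_aux[OF assms] by linarith
qed

lemma card_int_divisors_le:
  fixes n :: int
  assumes "n \<noteq> 0"
  shows "finite {d. d dvd n}" and "card {d. d dvd n} \<le> 2 * card {d. d dvd nat \<bar>n\<bar>}"
proof -
  let ?S = "{d. d dvd nat \<bar>n\<bar>}"
  have fin: "finite ?S" by (rule finite_divisors_nat) (use assms in simp)
  have sub: "{d. d dvd n} \<subseteq> int ` ?S \<union> (\<lambda>d. - int d) ` ?S"
  proof
    fix d assume "d \<in> {d. d dvd n}"
    then have "nat \<bar>d\<bar> \<in> ?S" by (simp add: nat_abs_dvd_iff)
    moreover have "d = int (nat \<bar>d\<bar>) \<or> d = - int (nat \<bar>d\<bar>)" by auto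
    ultimately show "d \<in> int ` ?S \<union> (\<lambda>d. - int d) ` ?S" by blast
  qed
  with fin show "finite {d. d dvd n}" by (meson finite_UnI finite_imageI finite_subset)
  have "card {d. d dvd n} \<le> card (int ` ?S \<union> (\<lambda>d. - int d) ` ?S)"
    using fin sub by (intro card_mono) auto
  also have "\<dots> \<le> card (int ` ?S) + card ((\<lambda>d. - int d) ` ?S)"
    by (rule card_Un_le)
  also have "\<dots> \<le> card ?S + card ?S"
    by (intro add_mono card_image_le fin)
  finally show "card {d. d dvd n} \<le> 2 * card ?S" by simp
qed

section \<open>Summability over the forms of a non-square discriminant\<close>

lemma forms_disc_nonzero:
  assumes "\<not> (\<exists>n::int. D = n^2)" and "b^2 - 4 * a * c = D"
  shows "a \<noteq> 0"
  using assms by auto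

text \<open>The exponent is 1/3 - 1, the divisor bound divided by 1 + b^2. Each half of the integers
  is compared with n^(-4/3).\<close>

lemma summable_on_int_one_plus_square_powr:
  "(\<lambda>b::int. (1 + (of_int b)^2 :: real) powr (-2/3)) summable_on UNIV"
proof -
  let ?f = "\<lambda>b::int. (1 + (of_int b)^2 :: real) powr (-2/3)"
  have "summable (\<lambda>n. (1 + (real n)^2) powr (-2/3))"
  proof (rule summable_comparison_test_ev)
    show "summable (\<lambda>n. real n powr (-4/3))" by (simp add: summable_real_powr_iff)
    show "\<forall>\<^sub>F n in sequentially. norm ((1 + (real n)^2) powr (-2/3)) \<le> real n powr (-4/3)"
      using eventually_gt_at_top[of 0]
    proof eventually_elim
      case (elim n)
      have "(1 + (real n)^2) powr (-2/3) \<le> ((real n)^2) powr (-2/3)"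
        using elim by (intro powr_mono2') auto
      also have "\<dots> = real n powr (-4/3)"
        using elim by (simp add: powr_powr flip: powr_numeral)
      finally show ?case by simp
    qed
  qed
  then have nat: "(\<lambda>n. (1 + (real n)^2) powr (-2/3)) summable_on UNIV"
    by (subst summable_on_UNIV_nonneg_real_iff) auto
  have 1: "?f summable_on range int"
    by (subst summable_on_reindex) (use nat in \<open>simp_all add: o_def\<close>)
  have 2: "?f summable_on range (\<lambda>n. - int n)"
    by (subst summable_on_reindex) (use nat in \<open>simp_all add: o_def inj_on_def\<close>)
  have "b \<in> range int \<union> range (\<lambda>n. - int n)" for b :: int
    by (cases b rule: int_cases2) auto
  then have "(UNIV::int set) = range int \<union> range (\<lambda>n. - int n)"
    by blast
  with summable_on_union[OF 1 2] show ?thesis by simp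
qed

text \<open>Forms are grouped by b. Since D is not a square, 4 a c = b^2 - D is nonzero, so a is one
  of the divisors of b^2 - D and determines c.\<close>

lemma summable_on_forms_disc:
  assumes "\<not> (\<exists>n::int. D = n^2)"
  shows "(\<lambda>(a, b, c). 1 / (1 + (of_int b)^2 :: real)) summable_on forms_disc D"
proof -
  define A where "A = (\<lambda>b::int. {(a, c). b^2 - 4 * a * c = D})"
  define C where "C = 2 * cbrt_const ^ 8 * (1 + \<bar>real_of_int D\<bar>) powr (1/3)"
  have C: "C \<ge> 0" using cbrt_const_ge_1 by (simp add: C_def)
  have finite_A: "finite (A b)"
    and card_A: "real (card (A b)) \<le> C * (1 + (real_of_int b)^2) powr (1/3)" for b
  proof -
    have inj: "inj_on fst (A b)"
      using forms_disc_nonzero[OF assms] by (auto simp: inj_on_def A_def)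
    have sub: "fst ` A b \<subseteq> {d. d dvd b^2 - D}"
      by (auto simp: A_def intro: dvdI[of _ _ "4 * _"])
    show fin: "finite (A b)"
    proof (cases "b^2 = D")
      case False
      then show ?thesis
        using inj sub card_int_divisors_le(1)[of "b^2 - D"] by (metis eq_iff_diff_eq_0 finite_imageD finite_subset)
    qed (use assms in auto)
    have nz: "b^2 - D \<noteq> 0" using assms by auto
    have "card (A b) = card (fst ` A b)" using card_image[OF inj] by simp
    also have "\<dots> \<le> card {d. d dvd b^2 - D}"
      using sub card_int_divisors_le(1)[OF nz] by (intro card_mono) auto
    also have "\<dots> \<le> 2 * card {d. d dvd nat \<bar>b^2 - D\<bar>}"
      by (rule card_int_divisors_le(2)[OF nz])
    finally have "real (card (A b)) \<le> 2 * real (card {d. d dvd nat \<bar>b^2 - D\<bar>})" by linarith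
    also have "\<dots> \<le> 2 * (cbrt_const ^ 8 * real (nat \<bar>b^2 - D\<bar>) powr (1/3))"
      using nz by (intro mult_left_mono card_divisors_le) auto
    also have "\<dots> \<le> 2 * (cbrt_const ^ 8 * ((1 + \<bar>real_of_int D\<bar>) * (1 + (real_of_int b)^2)) powr (1/3))"
    proof (intro mult_left_mono powr_mono2)
      have "real (nat \<bar>b^2 - D\<bar>) = \<bar>(real_of_int b)^2 - real_of_int D\<bar>" by simp
      also have "\<dots> \<le> (real_of_int b)^2 + \<bar>real_of_int D\<bar>"
        using abs_triangle_ineq4[of "(real_of_int b)^2" "real_of_int D"] by simp
      also have "\<dots> \<le> (1 + \<bar>real_of_int D\<bar>) * (1 + (real_of_int b)^2)"
        by (simp add: algebra_simps)
      finally show "real (nat \<bar>b^2 - D\<bar>) \<le> (1 + \<bar>real_of_int D\<bar>) * (1 + (real_of_int b)^2)" .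
    qed (use cbrt_const_ge_1 in auto)
    also have "\<dots> = C * (1 + (real_of_int b)^2) powr (1/3)"
      by (simp add: C_def powr_mult)
    finally show "real (card (A b)) \<le> C * (1 + (real_of_int b)^2) powr (1/3)" .
  qed
  have "(\<lambda>(b::int, (a::int, c::int)). 1 / (1 + (of_int b)^2 :: real)) summable_on (Sigma UNIV A)"
  proof (rule summable_on_SigmaI)
    show "((\<lambda>y. case (b, y) of (b, (a, c)) \<Rightarrow> 1 / (1 + (of_int b)^2 :: real)) has_sum
            real (card (A b)) / (1 + (of_int b)^2)) (A b)" for b
      using has_sum_finite[OF finite_A, of "\<lambda>y. case (b, y) of (b, (a, c)) \<Rightarrow> 1 / (1 + (of_int b)^2 :: real)" b]
      by (simp add: case_prod_unfold)
    have "(\<lambda>b::int. C * (1 + (of_int b)^2 :: real) powr (-2/3)) summable_on UNIV"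
      by (intro summable_on_cmult_right summable_on_int_one_plus_square_powr)
    then show "(\<lambda>b::int. real (card (A b)) / (1 + (of_int b)^2)) summable_on UNIV"
    proof (rule summable_on_comparison_test)
      fix b :: int
      have pos: "1 + (real_of_int b)^2 > 0" by (simp add: add_pos_nonneg)
      have "real (card (A b)) / (1 + (of_int b)^2) \<le> C * (1 + (real_of_int b)^2) powr (1/3) / (1 + (of_int b)^2)"
        using pos card_A by (intro divide_right_mono) auto
      also have "\<dots> = C * (1 + (real_of_int b)^2) powr (-2/3)"
        using pos powr_diff[of "1 + (real_of_int b)^2" "1/3" 1] by simp
      finally show "real (card (A b)) / (1 + (of_int b)^2) \<le> C * (1 + (real_of_int b)^2) powr (-2/3)" .
    qed auto
  qed auto
  also have "?this \<longleftrightarrow> (\<lambda>(a, b, c). 1 / (1 + (of_int b)^2 :: real)) summable_on forms_disc D"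
    by (rule summable_on_reindex_bij_witness[of _ "\<lambda>(a, b, c). (b, (a, c))" "\<lambda>(b, (a, c)). (a, b, c)"])
      (auto simp: A_def forms_disc_def)
  finally show ?thesis .
qed

section \<open>Lower bounds for forms and local finiteness of geodesics\<close>

lemma form_eval_1: "form_eval (a, b, c) z 1 = of_int a * z^2 + of_int b * z + of_int c"
  by (simp add: form_eval_def)

lemma norm_form_eval_square:
  assumes "Q \<in> forms_disc D"
  shows "(cmod (form_eval Q z 1))^2 = (geodesic_fun Q z)^2 + of_int D * (Im z)^2"
proof -
  obtain a b c where Q: "Q = (a, b, c)" by (cases Q)
  have "real_of_int D = (of_int b)^2 - 4 * of_int a * of_int c"
    using assms by (auto simp: Q forms_disc_def)
  then show ?thesis
    unfolding Q form_eval_1 cmod_power2 geodesic_fun_def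
    by (simp add: power2_eq_square, simp add: algebra_simps)
qed

text \<open>The identity |q|^2 = g^2 + D (Im z)^2 bounds y and |g| by |q|. Then a is controlled
  through 2 a (Im z)^2 = g - Re q, and b through Im q = Im z (2 a Re z + b).\<close>

lemma norm_form_eval_ge:
  assumes "(a, b, c) \<in> forms_disc D" "D > 0" "0 < y" "y \<le> Im z" "\<bar>Re z\<bar> \<le> X"
  defines "q \<equiv> form_eval (a, b, c) z 1"
  shows "y \<le> cmod q"
    and "\<bar>of_int a\<bar> \<le> cmod q / y^2"
    and "\<bar>of_int b\<bar> \<le> (1/y + 2 * X / y^2) * cmod q"
proof -
  note sq = norm_form_eval_square[OF assms(1), of z, folded q_def]
  have "y^2 \<le> (Im z)^2" using assms by (intro power_mono) auto
  also have "\<dots> \<le> real_of_int D * (Im z)^2"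
    using assms mult_right_mono[of 1 "real_of_int D" "(Im z)^2"] by simp
  also have "\<dots> \<le> (cmod q)^2" using sq by simp
  finally show "y \<le> cmod q" by (rule power2_le_imp_le) simp
  have g: "\<bar>geodesic_fun (a, b, c) z\<bar> \<le> cmod q"
    using sq assms by (intro power2_le_imp_le[OF _ norm_ge_zero]) simp
  have "2 * of_int a * (Im z)^2 = geodesic_fun (a, b, c) z - Re q"
    by (simp add: q_def form_eval_1 geodesic_fun_def cmod_power2) (simp add: power2_eq_square algebra_simps)
  then have "2 * \<bar>of_int a\<bar> * (Im z)^2 = \<bar>geodesic_fun (a, b, c) z - Re q\<bar>"
    by (metis abs_mult abs_numeral abs_power2)
  also have "\<dots> \<le> 2 * cmod q"
    using g abs_Re_le_cmod[of q] by linarith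
  finally have "\<bar>of_int a\<bar> * (Im z)^2 \<le> cmod q" by simp
  moreover have "\<bar>of_int a\<bar> * y^2 \<le> \<bar>of_int a\<bar> * (Im z)^2"
    using \<open>y^2 \<le> (Im z)^2\<close> by (intro mult_left_mono) auto
  ultimately show a: "\<bar>of_int a\<bar> \<le> cmod q / y^2"
    using assms by (simp add: field_simps)
  have "Im q = Im z * (2 * of_int a * Re z + of_int b)"
    by (simp add: q_def form_eval_1 power2_eq_square algebra_simps)
  then have "Im z * \<bar>2 * of_int a * Re z + of_int b\<bar> = \<bar>Im q\<bar>"
    using assms by (simp add: abs_mult)
  moreover have "y * \<bar>2 * of_int a * Re z + of_int b\<bar> \<le> Im z * \<bar>2 * of_int a * Re z + of_int b\<bar>"
    using assms by (intro mult_right_mono) auto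
  ultimately have "\<bar>2 * of_int a * Re z + of_int b\<bar> \<le> cmod q / y"
    using assms abs_Im_le_cmod[of q] by (simp add: field_simps)
  moreover have "\<bar>2 * of_int a * Re z\<bar> \<le> 2 * (cmod q / y^2) * X"
    unfolding abs_mult using a assms by (intro mult_mono) auto
  ultimately have "\<bar>of_int b\<bar> \<le> cmod q / y + 2 * (cmod q / y^2) * X" by linarith
  then show "\<bar>of_int b\<bar> \<le> (1/y + 2 * X / y^2) * cmod q"
    by (simp add: algebra_simps)
qed

text \<open>Two of the k factors |q| absorb 1 + b^2, and the other k - 2 are bounded below by y. The
  bound is uniform in z and sees the form only through b, as a majorant for the M-test must.\<close>

lemma norm_form_eval_power_ge:
  assumes "(a, b, c) \<in> forms_disc D" "D > 0" "0 < y" "y \<le> Im z" "\<bar>Re z\<bar> \<le> X" "k \<ge> 2"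
  shows "1 / cmod (form_eval (a, b, c) z 1) ^ k
     \<le> (1 / y^2 + (1/y + 2 * X / y^2)^2) / y ^ (k - 2) * (1 / (1 + (of_int b)^2))"
proof -
  define q where "q = form_eval (a, b, c) z 1"
  define L where "L = 1/y + 2 * X / y^2"
  note ge = norm_form_eval_ge[OF assms(1-5), folded q_def L_def]
  have q: "cmod q > 0" using ge(1) assms by linarith
  have "(of_int b)^2 \<le> (L * cmod q)^2"
    using ge(3) power_mono[of "\<bar>of_int b\<bar>" "L * cmod q" 2] by simp
  moreover have "1 \<le> (cmod q / y)^2"
    using ge(1) assms by simp
  ultimately have "1 + (of_int b)^2 \<le> (1/y^2 + L^2) * (cmod q)^2"
    by (simp add: field_simps power_mult_distrib)
  moreover have "y ^ (k - 2) * (cmod q)^2 \<le> cmod q ^ (k - 2) * (cmod q)^2"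
    using ge(1) assms by (intro mult_right_mono power_mono) auto
  then have "y ^ (k - 2) * (cmod q)^2 \<le> cmod q ^ k"
    by (metis assms(6) le_add_diff_inverse2 power_add)
  moreover have "1/y^2 + L^2 > 0" using assms by (simp add: add_pos_nonneg)
  ultimately have "y ^ (k - 2) * (1 + (of_int b)^2) \<le> (1/y^2 + L^2) * cmod q ^ k"
    by (smt (verit, ccfv_SIG) assms(3) mult.left_commute mult_left_mono zero_less_power)
  moreover have "1 / P \<le> E / Y * (1 / B)" if "Y * B \<le> E * P" "P > 0" "Y > 0" "B > 0" for P E Y B :: real
    using that by (simp add: field_simps)
  ultimately show ?thesis
    using q assms by (simp add: q_def L_def add_pos_nonneg)
qed

text \<open>On a geodesic |q| = sqrt D * Im z is bounded near \<tau>, which bounds a and b, and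
  these determine c. So only finitely many geodesics come near \<tau>, and avoiding each of them is
  an open condition.\<close>

lemma ball_avoids_geodesics:
  assumes "D > 0" and nsq: "\<not> (\<exists>n::int. D = n^2)" and \<tau>: "\<tau> \<in> upper_half_plane - exceptional_set D"
  obtains r where "r > 0"
    and "\<And>z. z \<in> ball \<tau> r \<Longrightarrow> Im \<tau> / 2 \<le> Im z \<and> Im z \<le> 2 * Im \<tau> \<and> \<bar>Re z\<bar> \<le> \<bar>Re \<tau>\<bar> + Im \<tau>"
    and "\<And>z Q. z \<in> ball \<tau> r \<Longrightarrow> Q \<in> forms_disc D \<Longrightarrow> geodesic_fun Q z \<noteq> 0"
proof -
  define y where "y = Im \<tau> / 2"
  define X where "X = \<bar>Re \<tau>\<bar> + Im \<tau>"
  have y: "y > 0" using \<tau> by (simp add: y_def upper_half_plane_def)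
  have near: "y \<le> Im z \<and> Im z \<le> 2 * Im \<tau> \<and> \<bar>Re z\<bar> \<le> X" if "z \<in> ball \<tau> y" for z
  proof -
    have "\<bar>Re \<tau> - Re z\<bar> < y" "\<bar>Im \<tau> - Im z\<bar> < y"
      using that abs_Re_le_cmod[of "\<tau> - z"] abs_Im_le_cmod[of "\<tau> - z"] by (auto simp: dist_norm)
    then show ?thesis using y unfolding y_def X_def by (intro conjI) linarith+
  qed
  define T where "T = {Q \<in> forms_disc D. \<exists>z\<in>ball \<tau> y. geodesic_fun Q z = 0}"
  define R where "R = sqrt (real_of_int D) * (2 * Im \<tau>)"
  define N where "N = max \<lceil>R / y^2\<rceil> \<lceil>(1/y + 2 * X / y^2) * R\<rceil>"
  have "T \<subseteq> (\<lambda>(a, b). (a, b, (b^2 - D) div (4 * a))) ` ({-N..N} \<times> {-N..N})"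
  proof
    fix Q assume "Q \<in> T"
    then obtain z where Q: "Q \<in> forms_disc D" and z: "z \<in> ball \<tau> y" "geodesic_fun Q z = 0"
      by (auto simp: T_def)
    obtain a b c where abc: "Q = (a, b, c)" by (cases Q)
    note near = near[OF z(1)]
    have "(cmod (form_eval Q z 1))^2 = (sqrt (real_of_int D) * Im z)^2"
      using norm_form_eval_square[OF Q, of z] z \<open>D > 0\<close> by (simp add: power_mult_distrib)
    then have "cmod (form_eval Q z 1) = sqrt (real_of_int D) * Im z"
      using near y \<open>D > 0\<close> by (subst (asm) power2_eq_iff_nonneg) auto
    also have "\<dots> \<le> R"
      unfolding R_def using near \<open>D > 0\<close> by (intro mult_left_mono) auto
    finally have q: "cmod (form_eval Q z 1) \<le> R" .
    note ge = norm_form_eval_ge[OF Q[unfolded abc] \<open>D > 0\<close> y, of z X, folded abc]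
    have "\<bar>of_int a\<bar> \<le> R / y^2"
      using ge(2) near divide_right_mono[OF q, of "y^2"] by auto
    then have a: "\<bar>a\<bar> \<le> N" unfolding N_def by linarith
    have "X \<ge> 0" using near by linarith
    then have "\<bar>of_int b\<bar> \<le> (1/y + 2 * X / y^2) * R"
      using ge(3) near y mult_left_mono[OF q, of "1/y + 2 * X / y^2"] by auto
    then have b: "\<bar>b\<bar> \<le> N" unfolding N_def by linarith
    have eq: "b^2 - 4 * a * c = D" using Q by (simp add: abc forms_disc_def)
    then have "c = (b^2 - D) div (4 * a)"
      using forms_disc_nonzero[OF nsq eq] by (auto simp: algebra_simps)
    with a b show "Q \<in> (\<lambda>(a, b). (a, b, (b^2 - D) div (4 * a))) ` ({-N..N} \<times> {-N..N})"
      by (auto simp: abc image_iff abs_le_iff)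
  qed
  then have "finite T" by (rule finite_subset) simp
  define U where "U = ball \<tau> y \<inter> (\<Inter>Q\<in>T. {z. geodesic_fun Q z \<noteq> 0})"
  have "open {z. geodesic_fun Q z \<noteq> 0}" for Q
    unfolding geodesic_fun_def case_prod_unfold
    by (intro open_Collect_neq continuous_intros)
  with \<open>finite T\<close> have "open U"
    unfolding U_def by (intro open_Int open_ball open_INT) auto
  moreover have "\<tau> \<in> U"
    using y \<tau> by (auto simp: U_def T_def exceptional_set_def)
  ultimately obtain r where r: "r > 0" "ball \<tau> r \<subseteq> U"
    by (meson open_contains_ball)
  show thesis
  proof (rule that[OF r(1)])
    show "Im \<tau> / 2 \<le> Im z \<and> Im z \<le> 2 * Im \<tau> \<and> \<bar>Re z\<bar> \<le> \<bar>Re \<tau>\<bar> + Im \<tau>" if "z \<in> ball \<tau> r" for z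
      using near[of z] that r(2) by (auto simp: U_def y_def X_def)
    show "geodesic_fun Q z \<noteq> 0" if "z \<in> ball \<tau> r" "Q \<in> forms_disc D" for z Q
      using that r(2) unfolding U_def T_def by blast
  qed
qed

section \<open>The derivatives of a single term\<close>

text \<open>Integrating only up to some \<open>w\<close> between \<open>v\<close> and 1 avoids the
  singularity and makes \<open>v\<close> an interior point. Continuity at 0 holds because k - 3/2 >
  0.\<close>

lemma psi_has_real_derivative:
  assumes "k \<ge> 2" "0 < v" "v < 1"
  shows "(psi k has_real_derivative 1/2 * (v powr (real k - 3/2) * (1 - v) powr (-1/2))) (at v)"
proof -
  let ?f = "\<lambda>u. u powr (real k - 3/2) * (1 - u) powr (-1/2)"
  obtain w where w: "v < w" "w < 1" using assms dense by blast
  have "continuous_on {0..w} ?f"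
    using assms w by (intro continuous_on_mult continuous_on_powr' continuous_intros) auto
  then have "((\<lambda>x. integral {0..x} ?f) has_real_derivative ?f v) (at v within {0..w})"
    by (rule integral_has_real_derivative) (use assms w in auto)
  moreover have "at v within {0..w} = at v"
    using assms w by (intro at_within_interior) auto
  ultimately show ?thesis
    using DERIV_cmult[of "\<lambda>x. integral {0..x} ?f" _ v UNIV "1/2"] by (simp add: psi_def[abs_def])
qed

text \<open>The first factor of the integrand is largest at u = v; the second integrates to 2 - 2
  sqrt (1 - v), which is at most 2 v. The resulting decay in \<open>v\<close> makes the first series
  converge.\<close>

lemma psi_bounds:
  assumes "k \<ge> 2" "0 \<le> v" "v < 1"
  shows "0 \<le> psi k v" and "psi k v \<le> v powr (real k - 1/2)"
proof -
  let ?f = "\<lambda>u. u powr (real k - 3/2) * (1 - u) powr (-1/2)"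
  let ?h = "\<lambda>u. v powr (real k - 3/2) * (1 - u) powr (-1/2)"
  have "continuous_on {0..v} ?f"
    using assms by (intro continuous_on_mult continuous_on_powr' continuous_intros) auto
  then have f: "?f integrable_on {0..v}" by (rule integrable_continuous_real)
  then show "0 \<le> psi k v"
    unfolding psi_def by (intro mult_nonneg_nonneg integral_nonneg) auto
  have "((\<lambda>u. (1 - u) powr (-1/2)) has_integral (- 2 * sqrt (1 - v) - - 2 * sqrt (1 - 0))) {0..v}"
  proof (rule fundamental_theorem_of_calculus)
    fix x assume "x \<in> {0..v}"
    then have "1 - x > 0" using assms by auto
    then show "((\<lambda>u. - 2 * sqrt (1 - u)) has_vector_derivative (1 - x) powr (-1/2)) (at x within {0..v})"
      unfolding has_real_derivative_iff_has_vector_derivative[symmetric]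
      by (auto intro!: derivative_eq_intros simp: powr_minus powr_half_sqrt field_simps)
  qed (use assms in auto)
  from has_integral_mult_right[OF this, of "v powr (real k - 3/2)"]
  have h: "(?h has_integral v powr (real k - 3/2) * (2 - 2 * sqrt (1 - v))) {0..v}"
    by simp
  have "integral {0..v} ?f \<le> integral {0..v} ?h"
  proof (rule integral_le[OF f])
    show "?h integrable_on {0..v}" using h by blast
    show "?f u \<le> ?h u" if "u \<in> {0..v}" for u
      using that assms by (intro mult_right_mono powr_mono2) auto
  qed
  also have "\<dots> = v powr (real k - 3/2) * (2 - 2 * sqrt (1 - v))"
    using h by (rule integral_unique)
  also have "\<dots> \<le> v powr (real k - 3/2) * (2 * v)"
  proof (intro mult_left_mono)
    have "(1 - v)^2 \<le> 1 - v"
      using assms mult_left_mono[of "1 - v" 1 "1 - v"] by (simp add: power2_eq_square)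
    then have "1 - v \<le> sqrt (1 - v)" by (rule real_le_rsqrt)
    then show "2 - 2 * sqrt (1 - v) \<le> 2 * v" by simp
  qed simp
  also have "\<dots> = 2 * v powr (real k - 1/2)"
    using assms powr_add[of v "real k - 3/2" 1] by simp
  finally show "psi k v \<le> v powr (real k - 1/2)"
    by (simp add: psi_def)
qed

text \<open>Both v and 1 - v are squares of explicit quotients, so the half-integral powers
  occurring in \<psi> and its derivative become integral powers.\<close>

lemma form_disc_argument:
  assumes Q: "Q \<in> forms_disc D" and D: "D > 0" and z: "Im z > 0"
  defines "v \<equiv> of_int D * (Im z)^2 / (cmod (form_eval Q z 1))^2"
  shows "form_eval Q z 1 \<noteq> 0"
    and "v = (sqrt (of_int D) * Im z / cmod (form_eval Q z 1))^2"
    and "0 < v"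
    and "1 - v = (\<bar>geodesic_fun Q z\<bar> / cmod (form_eval Q z 1))^2"
    and "geodesic_fun Q z \<noteq> 0 \<Longrightarrow> v < 1"
proof -
  note sq = norm_form_eval_square[OF Q, of z]
  have pos: "of_int D * (Im z)^2 > 0" using D z by simp
  then have n: "(cmod (form_eval Q z 1))^2 > 0"
    unfolding sq by (intro add_nonneg_pos) auto
  then show nz: "form_eval Q z 1 \<noteq> 0" by auto
  show "v = (sqrt (of_int D) * Im z / cmod (form_eval Q z 1))^2"
    using D by (simp add: v_def power_divide power_mult_distrib)
  show "0 < v" unfolding v_def using pos n by (rule divide_pos_pos)
  show eq: "1 - v = (\<bar>geodesic_fun Q z\<bar> / cmod (form_eval Q z 1))^2"
    using n sq by (simp add: v_def power_divide field_simps)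
  show "v < 1" if "geodesic_fun Q z \<noteq> 0"
  proof -
    have "1 - v > 0" unfolding eq using that nz by simp
    then show ?thesis by simp
  qed
qed

text \<open>The bound on \<psi> contributes |q|^(-(2 k - 1)) against the factor |q|^(k - 1), so both
  series share the majorant |q|^(-k).\<close>

lemma norm_F_term_le:
  assumes Q: "Q \<in> forms_disc D" and D: "D > 0" and z: "Im z > 0" and k: "k \<ge> 2"
  shows "norm (F_term k D z Q) \<le> (sqrt (of_int D) * Im z) ^ (2 * k - 1) / cmod (form_eval Q z 1) ^ k"
proof -
  define q where "q = form_eval Q z 1"
  define d where "d = sqrt (of_int D) * Im z"
  define v where "v = of_int D * (Im z)^2 / (cmod (form_eval Q z 1))^2"
  note v = form_disc_argument[OF Q D z, folded v_def q_def d_def]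
  have d: "d > 0" using D z by (simp add: d_def)
  have q: "cmod q > 0" using v(1) by simp
  have "norm (F_term k D z Q) \<le> cmod q ^ (k - 1) * v powr (real k - 1/2)"
  proof (cases "geodesic_fun Q z = 0")
    case True
    then show ?thesis by (simp add: F_term_def)
  next
    case False
    note psi = psi_bounds[OF k, of v]
    have "norm (F_term k D z Q) = cmod q ^ (k - 1) * psi k v"
      using False psi(1) v by (simp add: F_term_def norm_mult norm_power q_def[symmetric] v_def[symmetric, folded q_def] abs_sgn_eq)
    also have "\<dots> \<le> cmod q ^ (k - 1) * v powr (real k - 1/2)"
      using False psi(2) v by (intro mult_left_mono) auto
    finally show ?thesis .
  qed
  also have "v powr (real k - 1/2) = (d / cmod q) powr (real (2 * k - 1))"
    using d q k by (simp add: v(2) powr_powr right_diff_distrib of_nat_diff flip: powr_numeral)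
  also have "\<dots> = (d / cmod q) ^ (2 * k - 1)"
    using d q by (intro powr_realpow) simp
  also have "cmod q ^ (k - 1) * (d / cmod q) ^ (2 * k - 1) = d ^ (2 * k - 1) / cmod q ^ k"
  proof -
    have "2 * k - 1 = (k - 1) + k" using k by simp
    then show ?thesis using q by (simp add: power_divide power_add)
  qed
  finally show ?thesis by (simp add: q_def d_def)
qed

text \<open>The identity \<open>y * q' = \<i> * (g - q)\<close> below linearises all derivatives of the argument of \<open>\<psi>\<close>.\<close>

lemma argument_has_derivative:
  assumes Q: "(a, b, c) \<in> forms_disc D" and D: "D > 0" and z: "Im z > 0"
  defines "q \<equiv> form_eval (a, b, c) z 1"
  defines "W \<equiv> - \<i> * of_real (of_int D * Im z * geodesic_fun (a, b, c) z / (cmod q)^2) / q"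
  shows "((\<lambda>z. of_int D * (Im z)^2 / (cmod (form_eval (a, b, c) z 1))^2) has_derivative
           (\<lambda>t. 2 * Re (W * t))) (at z)"
proof -
  let ?q = "\<lambda>z. of_int a * z^2 + of_int b * z + of_int c :: complex"
  define q' where "q' = 2 * of_int a * z + of_int b"
  define g where "g = geodesic_fun (a, b, c) z"
  have q: "q = ?q z" by (simp add: q_def form_eval_1)
  have nz: "q \<noteq> 0" unfolding q_def by (rule form_disc_argument(1)[OF Q D z])
  have "(?q has_field_derivative q') (at z)"
    unfolding q'_def by (rule derivative_eq_intros refl | simp)+
  then have dq: "(?q has_derivative (\<lambda>t. q' * t)) (at z)"
    by (simp add: has_field_derivative_def)
  have key: "of_real (Im z) * q' = \<i> * (of_real g - q)"
    unfolding q q'_def g_def geodesic_fun_def case_prod_conv cmod_power2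
    by (simp add: complex_eq_iff power2_eq_square algebra_simps)
  have n: "(cmod q)^2 > 0" using nz by simp
  have num: "((\<lambda>z. of_int D * (Im z)^2) has_derivative (\<lambda>t. of_int D * (2 * Im z * Im t))) (at z)"
    by (auto intro!: derivative_eq_intros)
  have den: "((\<lambda>z. (Re (?q z))^2 + (Im (?q z))^2) has_derivative
      (\<lambda>t. 2 * Re q * Re (q' * t) + 2 * Im q * Im (q' * t))) (at z)"
    unfolding q
    by (rule has_derivative_eq_rhs[OF has_derivative_add[OF
          has_derivative_power[OF bounded_linear.has_derivative[OF bounded_linear_Re dq], of 2]
          has_derivative_power[OF bounded_linear.has_derivative[OF bounded_linear_Im dq], of 2]]])
      (simp add: mult_ac del: plus_complex.sel times_complex.sel)
  have "((\<lambda>z. of_int D * (Im z)^2 / ((Re (?q z))^2 + (Im (?q z))^2)) has_derivative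
      (\<lambda>t. (of_int D * (2 * Im z * Im t) * (cmod q)^2
          - of_int D * (Im z)^2 * (2 * Re q * Re (q' * t) + 2 * Im q * Im (q' * t))) / ((cmod q)^2 * (cmod q)^2))) (at z)"
    using has_derivative_divide'[OF num den] nz
    by (simp add: q[symmetric] cmod_power2[symmetric] del: plus_complex.sel times_complex.sel)
  moreover have "(of_int D * (2 * Im z * Im t) * (cmod q)^2
          - of_int D * (Im z)^2 * (2 * Re q * Re (q' * t) + 2 * Im q * Im (q' * t))) / ((cmod q)^2 * (cmod q)^2)
      = 2 * Re (W * t)" for t
  proof -
    \<comment> \<open>The factor \<open>Im z\<close> allows q' to be replaced by \<i> (g - q). The
      resulting |q|^2 term cancels the derivative of the numerator, and only the term with g is
      left.\<close>
    have "Im z * (Re q * Re (q' * t) + Im q * Im (q' * t)) = Re (cnj q * ((of_real (Im z) * q') * t))"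
      by (simp add: algebra_simps)
    also have "\<dots> = Re (\<i> * of_real g * (cnj q * t)) - Re (\<i> * (cnj q * q) * t)"
      unfolding key by (simp add: algebra_simps)
    also have "cnj q * q = of_real ((cmod q)^2)"
      by (simp add: complex_norm_square mult.commute del: of_real_power)
    finally have 1: "Im z * (Re q * Re (q' * t) + Im q * Im (q' * t)) = (cmod q)^2 * Im t - g * Im (cnj q * t)"
      by simp
    have inv: "1 / q = cnj q / of_real ((cmod q)^2)"
      using nz by (simp add: complex_norm_square del: of_real_power)
    have "W = - \<i> * of_real (of_int D * Im z * g / (cmod q)^2) * (1 / q)"
      by (simp add: W_def g_def)
    then have "W = - \<i> * of_real (of_int D * Im z * g / ((cmod q)^2 * (cmod q)^2)) * cnj q"
      unfolding inv by simp
    then have "W * t = of_real (of_int D * Im z * g / ((cmod q)^2 * (cmod q)^2)) * (- \<i> * (cnj q * t))"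
      by simp
    moreover have "Re (of_real r * (- \<i> * X)) = r * Im X" for r X by simp
    ultimately have "Re (W * t) = of_int D * Im z * g / ((cmod q)^2 * (cmod q)^2) * Im (cnj q * t)"
      by metis
    moreover have "of_int D * (2 * Im z * Im t) * (cmod q)^2
          - of_int D * (Im z)^2 * (2 * Re q * Re (q' * t) + 2 * Im q * Im (q' * t))
       = 2 * (of_int D * Im z) * ((cmod q)^2 * Im t - Im z * (Re q * Re (q' * t) + Im q * Im (q' * t)))"
      by (simp add: power2_eq_square algebra_simps)
    ultimately show ?thesis unfolding 1 by simp
  qed
  ultimately show ?thesis
    by (simp add: form_eval_1 cmod_power2)
qed

text \<open>The chain rule through \<psi> yields conjugate coefficients for \<open>t\<close> and
  \<open>cnj t\<close>; the outer power q^(k - 1) cancels the q-part of |q|^(2 k - 2).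
  Differentiating that outer power adds a multiple of the term itself, to the coefficient of
  \<open>t\<close> only.\<close>

lemma F_term_has_derivative:
  assumes Q: "(a, b, c) \<in> forms_disc D" and D: "D > 0" and z: "Im z > 0" and k: "k \<ge> 2"
    and g: "geodesic_fun (a, b, c) z \<noteq> 0"
  defines "q \<equiv> form_eval (a, b, c) z 1"
  defines "\<kappa> \<equiv> \<i> / 2 * of_real (sqrt (of_int D) ^ (2 * k - 1) * Im z ^ (2 * k - 2))"
  shows "((\<lambda>z. F_term k D z (a, b, c)) has_derivative
     (\<lambda>t. (of_nat (k - 1) * (2 * of_int a * z + of_int b) * F_term k D z (a, b, c)
            - \<kappa> / cnj q ^ (k - 1)) / q * t
          + \<kappa> / cnj q ^ k * cnj t)) (at z)"
proof -
  obtain j where j: "k = Suc (Suc j)" using k by (metis add_2_eq_Suc le_Suc_ex)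
  define q' where "q' = 2 * of_int a * z + of_int b"
  define sg where "sg = sgn (geodesic_fun (a, b, c) z)"
  define V where "V = (\<lambda>z. of_int D * (Im z)^2 / (cmod (form_eval (a, b, c) z 1))^2)"
  define d where "d = sqrt (of_int D) * Im z"
  define W where "W = - \<i> * of_real (of_int D * Im z * geodesic_fun (a, b, c) z / (cmod q)^2) / q"
  define \<psi>' where "\<psi>' = 1/2 * (V z powr (real k - 3/2) * (1 - V z) powr (-1/2))"
  have Vz: "V z = of_int D * (Im z)^2 / (cmod q)^2" by (simp add: V_def q_def)
  note V = form_disc_argument[OF Q D z, folded q_def d_def, folded Vz]
  have dpos: "d > 0" using D z by (simp add: d_def)
  have qpos: "cmod q > 0" using V(1) by simp
  have "((\<lambda>z. of_int a * z^2 + of_int b * z + of_int c :: complex) has_field_derivative q') (at z)"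
    unfolding q'_def by (rule derivative_eq_intros refl | simp)+
  then have dq: "((\<lambda>z. form_eval (a, b, c) z 1) has_derivative (\<lambda>t. q' * t)) (at z)"
    by (simp add: has_field_derivative_def form_eval_1)
  have dV: "(V has_derivative (\<lambda>t. 2 * Re (W * t))) (at z)"
    unfolding V_def W_def q_def by (rule argument_has_derivative[OF Q D z])
  have "((\<lambda>z. psi k (V z)) has_derivative (\<lambda>t. 2 * Re (W * t) * \<psi>')) (at z)"
    unfolding \<psi>'_def
    by (rule DERIV_compose_FDERIV[OF psi_has_real_derivative dV]) (use k V(3) V(5)[OF g] in \<open>auto simp: V_def q_def\<close>)
  then have "((\<lambda>z. of_real sg * form_eval (a, b, c) z 1 ^ (k - 1) * of_real (psi k (V z))) has_derivative
      (\<lambda>t. of_real sg * q ^ (k - 1) * of_real (2 * Re (W * t) * \<psi>')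
         + of_real sg * (of_nat (k - 1) * (q' * t) * q ^ (k - 1 - 1)) * of_real (psi k (V z)))) (at z)"
    unfolding q_def
    by (intro has_derivative_mult has_derivative_of_real has_derivative_power has_derivative_mult_right dq)
  \<comment> \<open>Off the geodesic the sign is locally constant, so it may be frozen at
    \<open>sg\<close> before differentiating.\<close>
  moreover have "open {w. geodesic_fun (a, b, c) w * geodesic_fun (a, b, c) z > 0}"
    unfolding geodesic_fun_def case_prod_conv by (intro open_Collect_less continuous_intros)
  moreover have "z \<in> {w. geodesic_fun (a, b, c) w * geodesic_fun (a, b, c) z > 0}"
    using g by (simp add: zero_less_mult_iff) linarith
  moreover have "of_real sg * form_eval (a, b, c) w 1 ^ (k - 1) * of_real (psi k (V w)) = F_term k D w (a, b, c)"
    if "w \<in> {w. geodesic_fun (a, b, c) w * geodesic_fun (a, b, c) z > 0}" for w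
    using that by (auto simp: F_term_def V_def sg_def zero_less_mult_iff)
  ultimately have deriv: "((\<lambda>z. F_term k D z (a, b, c)) has_derivative
      (\<lambda>t. of_real sg * q ^ (k - 1) * of_real (2 * Re (W * t) * \<psi>')
         + of_real sg * (of_nat (k - 1) * (q' * t) * q ^ (k - 1 - 1)) * of_real (psi k (V z)))) (at z)"
    by (rule has_derivative_transform_within_open)
  have "V z powr (real k - 3/2) = (d / cmod q) powr (real (2 * j + 1))"
    using dpos qpos by (simp add: V(2) j powr_powr flip: powr_numeral)
  also have "\<dots> = (d / cmod q) ^ (2 * j + 1)"
    using dpos qpos by (intro powr_realpow) simp
  finally have 1: "V z powr (real k - 3/2) = (d / cmod q) ^ (2 * j + 1)" .
  have 2: "(1 - V z) powr (-1/2) = cmod q / \<bar>geodesic_fun (a, b, c) z\<bar>"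
  proof -
    have "(x\<^sup>2) powr (-1/2) = inverse x" if "x > 0" for x :: real
      using powr_powr[of x 2 "-1/2"] that by (simp add: powr_minus)
    from this[of "\<bar>geodesic_fun (a, b, c) z\<bar> / cmod q"] show ?thesis
      using g qpos by (simp add: V(4))
  qed
  \<comment> \<open>The factor (1 - v)^(-1/2) brings 1/|g| and \<open>W\<close> brings g. Their
    product is the sign of g, which \<open>sg\<close> cancels, so \<kappa> is independent of the
    side of the geodesic.\<close>
  have "sg * \<psi>' * geodesic_fun (a, b, c) z = 1/2 * (d / cmod q) ^ (2 * j + 1) * cmod q"
    unfolding \<psi>'_def 1 2 using g by (simp add: sg_def sgn_if)
  also have "of_int D * Im z * \<dots> / (cmod q)^2
      = 1/2 * (sqrt (of_int D) ^ (2 * k - 1) * Im z ^ (2 * k - 2)) / (cmod q)^(2 * (k - 1))"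
    using qpos D unfolding d_def j
    by (simp add: power_divide power_mult_distrib power_add field_simps power2_eq_square)
  finally have E: "of_int D * Im z * (sg * \<psi>' * geodesic_fun (a, b, c) z) / (cmod q)^2
      = 1/2 * (sqrt (of_int D) ^ (2 * k - 1) * Im z ^ (2 * k - 2)) / (cmod q)^(2 * (k - 1))" .
  have "of_real (sg * \<psi>') * W
      = - \<i> * of_real (of_int D * Im z * (sg * \<psi>' * geodesic_fun (a, b, c) z) / (cmod q)^2) / q"
    by (simp add: W_def)
  also have "\<dots> = - \<kappa> / (of_real ((cmod q)^(2 * (k - 1))) * q)"
    unfolding E \<kappa>_def by simp
  also have "of_real ((cmod q)^(2 * (k - 1))) = (q * cnj q) ^ (k - 1)"
    by (simp only: power_mult of_real_power[of _ "k - 1"] complex_norm_square)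
  finally have T: "of_real (sg * \<psi>') * W = - \<kappa> / ((q * cnj q) ^ (k - 1) * q)" .
  have "cnj \<kappa> = - \<kappa>" by (simp add: \<kappa>_def)
  with arg_cong[OF T, of cnj] have T': "of_real (sg * \<psi>') * cnj W = \<kappa> / ((q * cnj q) ^ (k - 1) * cnj q)"
    by (simp add: mult.commute)
  have coeffs: "q ^ (k - 1) * (- \<kappa> / ((q * cnj q) ^ (k - 1) * q)) = - \<kappa> / (cnj q ^ (k - 1) * q)"
    "q ^ (k - 1) * (\<kappa> / ((q * cnj q) ^ (k - 1) * cnj q)) = \<kappa> / cnj q ^ k"
    using V(1) by (simp_all add: j power_mult_distrib)
  have F: "F_term k D z (a, b, c) = of_real sg * q ^ (k - 1) * of_real (psi k (V z))"
    by (simp add: F_term_def V_def sg_def q_def)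
  have "of_real sg * q ^ (k - 1) * of_real (2 * Re (W * t) * \<psi>')
         + of_real sg * (of_nat (k - 1) * (q' * t) * q ^ (k - 1 - 1)) * of_real (psi k (V z))
      = (of_nat (k - 1) * (2 * of_int a * z + of_int b) * F_term k D z (a, b, c)
            - \<kappa> / cnj q ^ (k - 1)) / q * t + \<kappa> / cnj q ^ k * cnj t" for t
  proof -
    have "of_real (2 * Re (W * t) * \<psi>') = of_real \<psi>' * complex_of_real (2 * Re (W * t))"
      by (simp only: of_real_mult mult.commute)
    \<comment> \<open>Writing 2 Re X as X + cnj X separates the two Wirtinger coefficients.\<close>
    also have "\<dots> = of_real \<psi>' * (W * t + cnj W * cnj t)"
      by (simp only: complex_add_cnj[symmetric] complex_cnj_mult)
    finally have "of_real (2 * Re (W * t) * \<psi>') = of_real \<psi>' * (W * t + cnj W * cnj t)" .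
    then have "of_real sg * q ^ (k - 1) * of_real (2 * Re (W * t) * \<psi>')
        = q ^ (k - 1) * (of_real (sg * \<psi>') * W) * t + q ^ (k - 1) * (of_real (sg * \<psi>') * cnj W) * cnj t"
      by (simp add: algebra_simps)
    also have "\<dots> = - \<kappa> / (cnj q ^ (k - 1) * q) * t + \<kappa> / cnj q ^ k * cnj t"
      unfolding T T' coeffs ..
    finally show ?thesis
      using V(1) unfolding F by (simp add: q'_def j field_simps)
  qed
  with deriv show ?thesis by simp
qed

section \<open>Splitting off the holomorphic part\<close>

text \<open>At w = z the left-hand side is (Im z)^m. Two variables are kept because the expansion is
  also used after polarization.\<close>

lemma power_diff_cnj_expand:
  fixes z w :: complex
  shows "((z - cnj w) / (2 * \<i>)) ^ m
    = (\<Sum>j\<le>m. of_nat (m choose j) / (2 * \<i>) ^ m * z ^ j * cnj ((- w) ^ (m - j)))"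
proof -
  have eq: "(z - cnj w) ^ m = (\<Sum>j\<le>m. of_nat (m choose j) * z ^ j * (- cnj w) ^ (m - j))"
    using binomial_ring[of z "- cnj w" m] by simp
  show ?thesis
    unfolding power_divide eq sum_divide_distrib by simp
qed

lemma has_sum_sum:
  fixes f :: "'j \<Rightarrow> 'q \<Rightarrow> 'a :: topological_comm_monoid_add"
  assumes "\<And>j. j \<in> J \<Longrightarrow> (f j has_sum s j) I"
  shows "((\<lambda>x. \<Sum>j\<in>J. f j x) has_sum (\<Sum>j\<in>J. s j)) I"
  using assms
  by (induction J rule: infinite_finite_induct) (auto intro!: has_sum_add)

text \<open>Convexity gives the primitives, and the mean value inequality along a radius bounds
  them. The normalisation at \<tau> makes the antiholomorphic coefficients vanish there.\<close>

lemma primitives_on_ball: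
  fixes f :: "nat \<Rightarrow> complex \<Rightarrow> complex"
  assumes f: "\<And>j. f j holomorphic_on ball \<tau> r" and r: "r > 0"
    and le: "\<And>j z. z \<in> ball \<tau> r \<Longrightarrow> j \<le> m \<Longrightarrow> norm (f j z) \<le> M"
  obtains P where "\<And>j z. z \<in> ball \<tau> r \<Longrightarrow> (P j has_field_derivative f j z) (at z)"
    and "\<And>j. P j \<tau> = 0"
    and "\<And>j z. z \<in> ball \<tau> r \<Longrightarrow> j \<le> m \<Longrightarrow> norm (P j z) \<le> M * r"
proof -
  have "\<exists>g. \<forall>z\<in>ball \<tau> r. (g has_field_derivative f j z) (at z within ball \<tau> r)" for j
    by (rule holomorphic_convex_primitive'[OF convex_ball open_ball f[of j]]) blast
  then obtain G where G: "\<And>j z. z \<in> ball \<tau> r \<Longrightarrow> (G j has_field_derivative f j z) (at z)"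
    by (metis at_within_open open_ball)
  define P where "P = (\<lambda>j z. G j z - G j \<tau>)"
  have P: "(P j has_field_derivative f j z) (at z)" if "z \<in> ball \<tau> r" for j z
    unfolding P_def using DERIV_diff[OF G[OF that] DERIV_const] by simp
  show thesis
  proof (rule that[of P])
    show "norm (P j z) \<le> M * r" if z: "z \<in> ball \<tau> r" and j: "j \<le> m" for j z
    proof -
      have "norm (P j z - P j \<tau>) \<le> M * norm (z - \<tau>)"
        by (rule field_differentiable_bound[of "ball \<tau> r" "P j" "f j"])
          (use P le j z r in \<open>auto intro: has_field_derivative_at_within\<close>)
      also have "\<dots> \<le> M * r"
      proof (rule mult_left_mono)
        show "norm (z - \<tau>) \<le> r" using z by (simp add: dist_norm norm_minus_commute)
        show "0 \<le> M" using le[OF z j] norm_ge_zero order_trans by blast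
      qed
      finally show ?thesis by (simp add: P_def)
    qed
    show "P j \<tau> = 0" for j by (simp add: P_def)
  qed (rule P)
qed

text \<open>Since \<open>y ^ (2 * k - 2)\<close> is a polynomial in \<open>z\<close> and \<open>cnj z\<close>, the non-holomorphic part of
  \<open>F_term\<close> on a disc is a polynomial in \<open>z\<close> with antiholomorphic coefficients \<open>cnj (P j z)\<close>, and
  its degree \<open>2 * k - 2\<close> makes it invisible to \<open>2 * k - 1\<close> derivatives in \<open>z\<close>.\<close>

lemma F_term_decomposition:
  fixes \<tau> :: complex
  assumes Q: "Q \<in> forms_disc D" and D: "D > 0" and k: "k \<ge> 2"
    and nsq: "\<not> (\<exists>n::int. D = n^2)" and r: "r > 0"
    and im: "\<And>z. z \<in> ball \<tau> r \<Longrightarrow> Im z > 0"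
    and geo: "\<And>z. z \<in> ball \<tau> r \<Longrightarrow> geodesic_fun Q z \<noteq> 0"
    and M: "\<And>z. z \<in> ball \<tau> r \<Longrightarrow> 1 / cmod (form_eval Q z 1) ^ k \<le> M"
    and R: "\<And>z. z \<in> ball \<tau> r \<Longrightarrow> cmod z \<le> R" "R \<ge> 1"
  defines "\<kappa> \<equiv> \<i> / 2 * of_real (sqrt (of_int D) ^ (2 * k - 1))"
  defines "m \<equiv> 2 * k - 2"
  shows "\<exists>P H. (\<forall>j. \<forall>z\<in>ball \<tau> r. (P j has_field_derivative (- z) ^ (m - j) / form_eval Q z 1 ^ k) (at z)) \<and>
    (\<forall>j. P j \<tau> = 0) \<and>
    (\<forall>j\<le>m. \<forall>z\<in>ball \<tau> r. norm (P j z) \<le> R ^ m * M * r) \<and>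
    H holomorphic_on ball \<tau> r \<and>
    (\<forall>z\<in>ball \<tau> r. F_term k D z Q
        = H z + \<kappa> * (\<Sum>j\<le>m. of_nat (m choose j) / (2 * \<i>) ^ m * z ^ j * cnj (P j z))) \<and>
    (deriv ^^ (2 * k - 1)) H \<tau> = - \<kappa> / (2 * \<i>) ^ m * fact m / form_eval Q \<tau> 1 ^ k"
proof -
  obtain a b c where abc: "Q = (a, b, c)" by (cases Q)
  define B where "B = ball \<tau> r"
  define l where "l = k - 1"
  have kl: "k = l + 1" and ml: "m = 2 * l" and kl': "2 * k - 1 = 2 * l + 1"
    using k by (auto simp: l_def m_def)
  define q where "q = (\<lambda>z. form_eval Q z 1)"
  define q' where "q' = (\<lambda>z::complex. 2 * of_int a * z + of_int b)"
  define C where "C = (\<lambda>j. of_nat (m choose j) / (2 * \<i>) ^ m :: complex)"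
  have q_eq: "q z = of_int a * z^2 + of_int b * z + of_int c" for z
    by (simp add: q_def abc form_eval_1)
  have q_eq': "q z = of_real (real_of_int a) * z^2 + of_real (real_of_int b) * z + of_real (real_of_int c)" for z
    by (simp add: q_eq)
  have qnz: "q z \<noteq> 0" if "z \<in> B" for z
    using form_disc_argument(1)[OF Q D im] that by (simp add: q_def B_def)
  have qhol: "q holomorphic_on S" for S
    unfolding q_eq[abs_def] by (intro holomorphic_intros)
  have \<tau>: "\<tau> \<in> B" using r by (simp add: B_def)
  have open_B: "open B" and conn_B: "connected B" by (auto simp: B_def)
  have expand: "((z - cnj w) / (2 * \<i>)) ^ m = (\<Sum>j\<le>m. C j * z ^ j * cnj ((- w) ^ (m - j)))" for z w
    unfolding C_def by (rule power_diff_cnj_expand)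
  have Im_eq: "of_real (Im z) = (z - cnj z) / (2 * \<i>)" for z
    by (simp add: complex_eq_iff)

  \<comment> \<open>The derivatives of the \<open>P j\<close> are chosen so that the sum of
    \<open>C j * z ^ j * cnj (P j z)\<close> has antiholomorphic derivative (Im z)^m / cnj q^k, by
    the binomial expansion.\<close>
  obtain P where P: "\<And>j z. z \<in> B \<Longrightarrow> (P j has_field_derivative (- z) ^ (m - j) / q z ^ k) (at z)"
    and P\<tau>: "\<And>j. P j \<tau> = 0"
    and P_le: "\<And>j z. z \<in> B \<Longrightarrow> j \<le> m \<Longrightarrow> norm (P j z) \<le> R ^ m * M * r"
  proof (rule primitives_on_ball[OF _ r])
    show "(\<lambda>z. (- z) ^ (m - j) / q z ^ k) holomorphic_on ball \<tau> r" for j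
      using qnz by (intro holomorphic_intros qhol) (auto simp: B_def)
    show "norm ((- z) ^ (m - j) / q z ^ k) \<le> R ^ m * M" if z: "z \<in> ball \<tau> r" and "j \<le> m" for j z
    proof -
      have "cmod z ^ (m - j) \<le> R ^ (m - j)" using R(1)[OF z] by (intro power_mono) auto
      also have "\<dots> \<le> R ^ m" using R(2) by (intro power_increasing) auto
      finally have "cmod z ^ (m - j) * (1 / cmod (q z) ^ k) \<le> R ^ m * M"
        using M[OF z] R(2) by (intro mult_mono) (auto simp: q_def)
      then show ?thesis by (simp add: norm_divide norm_power)
    qed
  qed (auto simp: B_def)
  define N where "N = (\<lambda>z. \<Sum>j\<le>m. C j * z ^ j * cnj (P j z))"
  define dN where "dN = (\<lambda>z. \<Sum>j\<le>m. C j * (of_nat j * z ^ (j - 1)) * cnj (P j z))"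
  \<comment> \<open>The subtracted term has the same antiholomorphic derivative as
    \<open>F_term\<close>, so \<open>H\<close> is holomorphic.\<close>
  define H where "H = (\<lambda>z. F_term k D z Q - \<kappa> * N z)"
  define Y where "Y = (\<lambda>z. of_real (Im z) ^ m :: complex)"
  have H': "(H has_field_derivative
      (of_nat l * q' z * F_term k D z Q - \<kappa> * Y z / cnj (q z) ^ l) / q z - \<kappa> * dN z) (at z)"
    if z: "z \<in> B" for z
  proof -
    have "(N has_derivative (\<lambda>t. dN z * t +
        (\<Sum>j\<le>m. C j * z ^ j * cnj ((- z) ^ (m - j) / q z ^ k)) * cnj t)) (at z)"
      unfolding N_def dN_def
      by (rule has_derivative_sum_mult_cnj) (auto intro!: derivative_eq_intros P[OF z])
    also have "(\<Sum>j\<le>m. C j * z ^ j * cnj ((- z) ^ (m - j) / q z ^ k)) = Y z / cnj (q z) ^ k"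
      unfolding Y_def Im_eq expand by (simp add: sum_divide_distrib)
    finally have "((\<lambda>z. \<kappa> * N z) has_derivative
        (\<lambda>t. \<kappa> * (dN z * t + Y z / cnj (q z) ^ k * cnj t))) (at z)"
      by (intro has_derivative_mult_right)
    moreover have "((\<lambda>z. F_term k D z Q) has_derivative
      (\<lambda>t. (of_nat l * q' z * F_term k D z Q - \<kappa> * Y z / cnj (q z) ^ l) / q z * t
          + \<kappa> * Y z / cnj (q z) ^ k * cnj t)) (at z)"
      using F_term_has_derivative[OF Q[unfolded abc] D im k, of z] geo[of z] z
      by (simp add: B_def abc l_def q'_def q_def Y_def \<kappa>_def m_def mult.assoc)
    ultimately have "(H has_derivative
      (\<lambda>t. ((of_nat l * q' z * F_term k D z Q - \<kappa> * Y z / cnj (q z) ^ l) / q z * t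
          + \<kappa> * Y z / cnj (q z) ^ k * cnj t) - \<kappa> * (dN z * t + Y z / cnj (q z) ^ k * cnj t))) (at z)"
      unfolding H_def by (rule has_derivative_diff[rotated])
    then show ?thesis
      unfolding has_field_derivative_def by (rule has_derivative_eq_rhs) (simp add: fun_eq_iff algebra_simps diff_divide_distrib)
  qed
  then have Hhol: "H holomorphic_on B"
    using open_B by (auto simp: holomorphic_on_open)

  have ode: "q z * deriv H z - of_nat l * q' z * H z
      = - \<kappa> / cnj (q \<tau>) ^ l * ((z - cnj \<tau>) / (2 * \<i>)) ^ m" if z: "z \<in> B" for z
  proof -
    \<comment> \<open>The equation for \<open>F_term\<close> is written as a vanishing sum of
      products of holomorphic and conjugated holomorphic factors: \<open>f1\<close> comes from the
      subtracted part, \<open>f2\<close> from the right-hand side, \<open>f3\<close> from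
      \<open>H\<close>. After polarization the second variable is set to \<tau>, where the
      \<open>P j\<close> vanish and \<open>f1\<close> drops out.\<close>
    define f1 where "f1 = (\<lambda>j z. \<kappa> * C j * (q z * (of_nat j * z ^ (j - 1)) - of_nat l * q' z * z ^ j))"
    define f2 where "f2 = (\<lambda>j z. \<kappa> * C j * z ^ j)"
    define g2 where "g2 = (\<lambda>j z. (- z) ^ (m - j) / q z ^ l)"
    define f3 where "f3 = (\<lambda>z. q z * deriv H z - of_nat l * q' z * H z)"
    let ?f = "case_sum f1 (case_sum f2 (\<lambda>_::unit. f3))"
    let ?g = "case_sum P (case_sum g2 (\<lambda>_::unit. \<lambda>_. 1))"
    have split: "(\<Sum>j\<in>{..m} <+> {..m} <+> {()}. ?f j z * cnj (?g j w))
        = (\<Sum>j\<le>m. f1 j z * cnj (P j w)) + ((\<Sum>j\<le>m. f2 j z * cnj (g2 j w)) + f3 z)" for z w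
      by (simp add: sum.Plus o_def)
    have sum2: "(\<Sum>j\<le>m. f2 j z * cnj (g2 j w)) = \<kappa> / cnj (q w) ^ l * ((z - cnj w) / (2 * \<i>)) ^ m" for z w
      unfolding expand by (simp add: f2_def g2_def sum_distrib_left mult_ac)
    have "(\<Sum>j\<in>{..m} <+> {..m} <+> {()}. ?f j z * cnj (?g j \<tau>)) = 0"
    proof (rule sum_mult_cnj_polarization[OF open_B conn_B _ _ _ z \<tau>])
      have "q' holomorphic_on B" unfolding q'_def by (intro holomorphic_intros)
      then have "f1 j holomorphic_on B" "f2 j holomorphic_on B" "f3 holomorphic_on B" for j
        unfolding f1_def f2_def f3_def
        by (intro holomorphic_intros qhol Hhol holomorphic_deriv open_B; assumption)+
      then show "?f j holomorphic_on B" for j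
        by (auto split: sum.split)
      have "P j holomorphic_on B" for j
        using P open_B by (auto simp: holomorphic_on_open)
      moreover have "g2 j holomorphic_on B" for j
        unfolding g2_def using qnz by (intro holomorphic_intros qhol) auto
      ultimately show "?g j holomorphic_on B" for j
        by (auto split: sum.split)
      fix w assume w: "w \<in> B"
      have "q w * (x / q w - y) = x - q w * y" for x y
        using qnz[OF w] by (simp add: field_simps)
      then have "q w * deriv H w = of_nat l * q' w * F_term k D w Q - \<kappa> * Y w / cnj (q w) ^ l - q w * \<kappa> * dN w"
        unfolding DERIV_imp_deriv[OF H'[OF w]] by (simp add: mult_ac)
      then have "f3 w = - (\<kappa> * Y w / cnj (q w) ^ l) - \<kappa> * (q w * dN w - of_nat l * q' w * N w)"
        by (simp add: f3_def H_def algebra_simps)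
      moreover have "(\<Sum>j\<le>m. f1 j w * cnj (P j w)) = \<kappa> * (q w * dN w - of_nat l * q' w * N w)"
        unfolding dN_def N_def sum_distrib_left sum_subtractf[symmetric]
        by (intro sum.cong) (simp_all add: f1_def algebra_simps)
      moreover have "(\<Sum>j\<le>m. f2 j w * cnj (g2 j w)) = \<kappa> * Y w / cnj (q w) ^ l"
        unfolding sum2 Y_def Im_eq by simp
      ultimately show "(\<Sum>j\<in>{..m} <+> {..m} <+> {()}. ?f j w * cnj (?g j w)) = 0"
        unfolding split by simp
    qed
    then show ?thesis
      unfolding split sum2 using P\<tau> by (simp add: f3_def add_eq_0_iff)
  qed
  \<comment> \<open>The right-hand side vanishes at s = cnj \<tau>. Since q has real coefficients, q
    (cnj \<tau>)^l equals cnj (q \<tau>)^l and cancels the denominator.\<close>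
  have "(deriv ^^ (2 * l + 1)) H \<tau>
      = (- \<kappa> / (cnj (q \<tau>) ^ l * (2 * \<i>) ^ m)) * fact (2 * l) * q (cnj \<tau>) ^ l / q \<tau> ^ (l + 1)"
    unfolding q_eq'
  proof (rule quadratic_ode_higher_deriv)
    have D_eq: "b^2 - 4 * a * c = D" using Q by (simp add: abc forms_disc_def)
    show "real_of_int a \<noteq> 0" using forms_disc_nonzero[OF nsq D_eq] by simp
    have "(real_of_int b)^2 - 4 * real_of_int a * real_of_int c = real_of_int D"
      using D_eq by auto
    with D show "(real_of_int b)^2 - 4 * real_of_int a * real_of_int c > 0" by simp
    show "Im \<tau> \<noteq> 0" "Im (cnj \<tau>) \<noteq> 0" using im[of \<tau>] r by auto
    show "r > 0" "H holomorphic_on ball \<tau> r" using r Hhol by (auto simp: B_def)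
    fix z assume "z \<in> ball \<tau> r"
    then show "(of_real (real_of_int a) * z^2 + of_real (real_of_int b) * z + of_real (real_of_int c)) * deriv H z
        - of_nat l * (2 * of_real (real_of_int a) * z + of_real (real_of_int b)) * H z
        = - \<kappa> / (cnj (of_real (real_of_int a) * \<tau>^2 + of_real (real_of_int b) * \<tau> + of_real (real_of_int c)) ^ l
            * (2 * \<i>) ^ m) * (z - cnj \<tau>) ^ (2 * l)"
      using ode[of z] unfolding power_divide by (simp add: B_def q_eq q'_def ml)
  qed
  moreover have "q (cnj \<tau>) = cnj (q \<tau>)" by (simp add: q_eq)
  ultimately have "(deriv ^^ (2 * k - 1)) H \<tau> = - \<kappa> / (2 * \<i>) ^ m * fact m / q \<tau> ^ k"
    unfolding kl' kl ml[symmetric] using qnz[OF \<tau>] by (simp add: ml del: funpow.simps)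
  moreover have "F_term k D z Q = H z + \<kappa> * (\<Sum>j\<le>m. C j * z ^ j * cnj (P j z))" for z
    by (simp add: H_def N_def)
  ultimately show ?thesis
    using P P\<tau> P_le Hhol unfolding B_def q_def C_def by blast
qed

section \<open>Summation over all forms and the two differential identities\<close>

theorem theorem1p2:
  fixes k :: nat and D :: int and \<tau> :: complex
  assumes "k > 1"
    and "discriminant D" and "D > 0" and "\<not> (\<exists>n::int. D = n^2)"
    and "\<tau> \<in> upper_half_plane - exceptional_set D"
  shows "f_term k \<tau> summable_on forms_disc D \<and>
    F_term k D \<tau> summable_on forms_disc D \<and>
    (\<forall>j < 2*k - 1. (D_op ^^ j) (F_series k D) differentiable (at \<tau>)) \<and>
    xi_op (2 - 2 * int k) (F_series k D) \<tau> =
      of_real (of_int D powr (1/2 - real k)) * f_series k D \<tau> \<and>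
    (D_op ^^ (2*k - 1)) (F_series k D) \<tau> =
      - of_real (fact (2*k - 2) / (4 * pi) ^ (2*k - 1) * of_int D powr (1/2 - real k)) *
      f_series k D \<tau>"
proof -
  have k: "k \<ge> 2" using assms(1) by simp
  note D = assms(3) and nsq = assms(4)
  define I where "I = forms_disc D"
  define q where "q = (\<lambda>Q. form_eval Q \<tau> 1)"
  define m where "m = 2 * k - 2"
  define \<delta> where "\<delta> = sqrt (real_of_int D)"
  define \<kappa> where "\<kappa> = \<i> / 2 * of_real (\<delta> ^ (2 * k - 1))"
  define C where "C = (\<lambda>j. of_nat (m choose j) / (2 * \<i>) ^ m :: complex)"
  have Im_\<tau>: "Im \<tau> > 0" using assms(5) by (simp add: upper_half_plane_def)
  obtain r where r: "r > 0"
    and near: "\<And>z. z \<in> ball \<tau> r \<Longrightarrow> Im \<tau> / 2 \<le> Im z \<and> Im z \<le> 2 * Im \<tau> \<and> \<bar>Re z\<bar> \<le> \<bar>Re \<tau>\<bar> + Im \<tau>"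
    and geo: "\<And>z Q. z \<in> ball \<tau> r \<Longrightarrow> Q \<in> forms_disc D \<Longrightarrow> geodesic_fun Q z \<noteq> 0"
    using ball_avoids_geodesics[OF D nsq assms(5)] by metis
  define B where "B = ball \<tau> r"
  have \<tau>B: "\<tau> \<in> B" and open_B: "open B" using r by (auto simp: B_def)
  have im: "Im z > 0" if "z \<in> B" for z
    using near[of z] that Im_\<tau> unfolding B_def by linarith
  define R where "R = max 1 (cmod \<tau> + r)"
  have R: "R \<ge> 1" by (simp add: R_def)
  have z_le: "cmod z \<le> R" if "z \<in> B" for z
  proof -
    have "cmod z \<le> cmod \<tau> + cmod (z - \<tau>)" by (metis add.commute diff_add_cancel norm_triangle_ineq)
    also have "cmod (z - \<tau>) \<le> r" using that by (simp add: B_def dist_norm norm_minus_commute)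
    finally show ?thesis by (simp add: R_def)
  qed

  \<comment> \<open>The constant of \<open>norm_form_eval_power_ge\<close> for the lower bound Im
    \<tau> / 2 on Im z and the bound |Re \<tau>| + Im \<tau> on |Re z|, both valid on the
    disc.\<close>
  define K0 where "K0 = (1 / (Im \<tau> / 2)^2 + (1 / (Im \<tau> / 2) + 2 * (\<bar>Re \<tau>\<bar> + Im \<tau>) / (Im \<tau> / 2)^2)^2)
    / (Im \<tau> / 2) ^ (k - 2)"
  define M where "M = (\<lambda>Q::int\<times>int\<times>int. K0 * (case Q of (a, b, c) \<Rightarrow> 1 / (1 + (of_int b)^2)))"
  have M: "1 / cmod (form_eval Q z 1) ^ k \<le> M Q" if "Q \<in> I" "z \<in> B" for Q z
  proof -
    obtain a b c where Q: "Q = (a, b, c)" by (cases Q)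
    have "1 / cmod (form_eval (a, b, c) z 1) ^ k \<le> K0 * (1 / (1 + (of_int b)^2))"
      unfolding K0_def
      by (rule norm_form_eval_power_ge) (use that near[of z] Im_\<tau> D k in \<open>auto simp: Q I_def B_def\<close>)
    then show ?thesis by (simp add: Q M_def)
  qed
  have M_summable: "(\<lambda>Q. c * M Q) summable_on I" for c
    unfolding M_def I_def by (intro summable_on_cmult_right summable_on_forms_disc nsq)

  define decomp where "decomp = (\<lambda>Q P H.
    (\<forall>j. \<forall>z\<in>B. (P j has_field_derivative (- z) ^ (m - j) / form_eval Q z 1 ^ k) (at z)) \<and>
    (\<forall>j. P j \<tau> = 0) \<and>
    (\<forall>j\<le>m. \<forall>z\<in>B. norm (P j z) \<le> R ^ m * M Q * r) \<and>
    H holomorphic_on B \<and>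
    (\<forall>z\<in>B. F_term k D z Q = H z + \<kappa> * (\<Sum>j\<le>m. C j * z ^ j * cnj (P j z))) \<and>
    (deriv ^^ (2 * k - 1)) H \<tau> = - \<kappa> / (2 * \<i>) ^ m * fact m / form_eval Q \<tau> 1 ^ k)"
  have "\<exists>P H. decomp Q P H" if "Q \<in> I" for Q
    unfolding decomp_def B_def m_def \<kappa>_def \<delta>_def C_def
    by (intro F_term_decomposition D k nsq r)
      (use that im geo M z_le R in \<open>auto simp: B_def I_def\<close>)
  then obtain P H where decomp: "\<And>Q. Q \<in> I \<Longrightarrow> decomp Q (P Q) (H Q)"
    by metis
  have P: "(P Q j has_field_derivative (- z) ^ (m - j) / form_eval Q z 1 ^ k) (at z)"
    and P\<tau>: "P Q j \<tau> = 0"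
    and P_le: "j \<le> m \<Longrightarrow> norm (P Q j z) \<le> R ^ m * M Q * r"
    and H: "H Q holomorphic_on B"
    and F_eq: "F_term k D z Q = H Q z + \<kappa> * (\<Sum>j\<le>m. C j * z ^ j * cnj (P Q j z))"
    and H_deriv: "(deriv ^^ (2 * k - 1)) (H Q) \<tau> = - \<kappa> / (2 * \<i>) ^ m * fact m / q Q ^ k"
    if "Q \<in> I" "z \<in> B" for Q j z
    using decomp[OF that(1)] that(2) unfolding decomp_def q_def by blast+
  note P\<tau> = P\<tau>[OF _ \<tau>B] and H = H[OF _ \<tau>B] and H_deriv = H_deriv[OF _ \<tau>B]

  \<comment> \<open>\<open>H Q\<close> is the difference of \<open>F_term\<close> and its
    non-holomorphic part. Each is bounded by a constant times \<open>M Q\<close>, and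
    \<open>C1\<close> adds the two constants.\<close>
  define C1 where "C1 = (\<delta> * R) ^ (2 * k - 1) + cmod \<kappa> * (\<Sum>j\<le>m. cmod (C j) * R ^ m * (R ^ m * r))"
  have H_le: "norm (H Q z) \<le> C1 * M Q" if Q: "Q \<in> I" and z: "z \<in> B" for Q z
  proof -
    have "norm (H Q z) = norm (F_term k D z Q - \<kappa> * (\<Sum>j\<le>m. C j * z ^ j * cnj (P Q j z)))"
      using F_eq[OF that] by simp
    also have "\<dots> \<le> norm (F_term k D z Q) + norm (\<kappa> * (\<Sum>j\<le>m. C j * z ^ j * cnj (P Q j z)))"
      by (rule norm_triangle_ineq4)
    also have "norm (F_term k D z Q) \<le> (\<delta> * R) ^ (2 * k - 1) * M Q"
    proof -
      have "norm (F_term k D z Q) \<le> (\<delta> * Im z) ^ (2 * k - 1) * (1 / cmod (form_eval Q z 1) ^ k)"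
        using norm_F_term_le[of Q D z k] Q im[OF z] D k by (simp add: I_def \<delta>_def)
      also have "\<dots> \<le> (\<delta> * R) ^ (2 * k - 1) * M Q"
      proof (intro mult_mono power_mono M Q z)
        show "Im z \<le> R" using z_le[OF z] abs_Im_le_cmod[of z] by linarith
      qed (use im[OF z] D R in \<open>auto simp: \<delta>_def\<close>)
      finally show ?thesis .
    qed
    also have "norm (\<kappa> * (\<Sum>j\<le>m. C j * z ^ j * cnj (P Q j z)))
        \<le> cmod \<kappa> * (\<Sum>j\<le>m. cmod (C j) * R ^ m * (R ^ m * M Q * r))"
      unfolding norm_mult
    proof (rule mult_left_mono[OF order_trans[OF norm_sum sum_mono]])
      fix j assume "j \<in> {..m}"
      then have j: "j \<le> m" by simp
      have "cmod z ^ j \<le> R ^ j" using z_le[OF z] by (intro power_mono) auto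
      also have "\<dots> \<le> R ^ m" using R j by (intro power_increasing) auto
      finally have "cmod z ^ j \<le> R ^ m" .
      then show "norm (C j * z ^ j * cnj (P Q j z)) \<le> cmod (C j) * R ^ m * (R ^ m * M Q * r)"
        unfolding norm_mult norm_power using P_le[OF Q z j] R by (intro mult_mono) auto
    qed simp
    finally show ?thesis
      by (simp add: C1_def algebra_simps sum_distrib_left)
  qed

  define Hs where "Hs = (\<lambda>z. \<Sum>\<^sub>\<infinity>Q\<in>I. H Q z)"
  define Ps where "Ps = (\<lambda>j z. \<Sum>\<^sub>\<infinity>Q\<in>I. P Q j z)"
  have Hs_hol: "Hs holomorphic_on B"
    unfolding Hs_def
    by (rule holomorphic_higher_deriv_infsum(1)[OF open_B H H_le M_summable])
  have Hs_sum: "((\<lambda>Q. (deriv ^^ n) (H Q) z) has_sum (deriv ^^ n) Hs z) I" if "z \<in> B" for n z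
    unfolding Hs_def
    by (rule holomorphic_higher_deriv_infsum(2)[OF open_B H H_le M_summable that])
  have P_hol: "P Q j holomorphic_on B" if "Q \<in> I" for Q j
    using P[OF that] open_B by (auto simp: holomorphic_on_open)
  have P_le': "norm (P Q j z) \<le> R ^ m * r * M Q" if "Q \<in> I" "j \<le> m" "z \<in> B" for Q j z
    using P_le[OF that(1,3,2)] by (simp add: mult_ac)
  have Ps_hol: "Ps j holomorphic_on B" if "j \<le> m" for j
    unfolding Ps_def
    by (rule holomorphic_higher_deriv_infsum(1)[OF open_B P_hol P_le'[OF _ that] M_summable])
  have Ps_sum: "((\<lambda>Q. (deriv ^^ n) (P Q j) z) has_sum (deriv ^^ n) (Ps j) z) I" if "z \<in> B" "j \<le> m" for n j z
    unfolding Ps_def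
    by (rule holomorphic_higher_deriv_infsum(2)[OF open_B P_hol P_le'[OF _ that(2)] M_summable that(1)])
  have Ps\<tau>: "Ps j \<tau> = 0" for j
    unfolding Ps_def by (rule infsum_0) (use P\<tau> in auto)

  have F_sum: "((\<lambda>Q. F_term k D z Q) has_sum Hs z + \<kappa> * (\<Sum>j\<le>m. C j * z ^ j * cnj (Ps j z))) I"
    if z: "z \<in> B" for z
  proof -
    have "((\<lambda>Q. H Q z + \<kappa> * (\<Sum>j\<le>m. C j * z ^ j * cnj (P Q j z))) has_sum
        Hs z + \<kappa> * (\<Sum>j\<le>m. C j * z ^ j * cnj (Ps j z))) I"
    proof (intro has_sum_add has_sum_cmult_right has_sum_sum)
      show "((\<lambda>Q. H Q z) has_sum Hs z) I" using Hs_sum[OF z, of 0] by simp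
      fix j assume "j \<in> {..m}"
      then show "((\<lambda>Q. cnj (P Q j z)) has_sum cnj (Ps j z)) I"
        using Ps_sum[OF z, of j 0] by (simp add: has_sum_cnj_iff)
    qed
    then show ?thesis
      by (rule has_sum_cong[THEN iffD1, rotated]) (simp add: F_eq z)
  qed

  have m_eq: "2 * k - 1 = m + 1" using k by (simp add: m_def)
  define S where "S = (\<Sum>\<^sub>\<infinity>Q\<in>I. 1 / q Q ^ k)"
  have f_term_eq: "f_term k \<tau> Q = 1 / q Q ^ k" for Q
    by (simp add: f_term_def q_def power_int_minus field_simps)
  have P_deriv: "(deriv ^^ 1) (P Q j) \<tau> = (- \<tau>) ^ (m - j) * (1 / q Q ^ k)" if "Q \<in> I" for Q j
    using DERIV_imp_deriv[OF P[OF that \<tau>B]] by (simp add: q_def)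
  \<comment> \<open>Convergence of the second series is read off from the derivative of
    \<open>Ps m\<close>, where the factor (- \<tau>)^(m - j) is 1.\<close>
  have S: "((\<lambda>Q. 1 / q Q ^ k) has_sum S) I"
  proof -
    have "((\<lambda>Q. 1 / q Q ^ k) has_sum (deriv ^^ 1) (Ps m) \<tau>) I"
      using Ps_sum[OF \<tau>B order_refl, of 1]
      by (rule has_sum_cong[THEN iffD1, rotated]) (simp only: P_deriv diff_self_eq_0 power_0 mult_1)
    then show ?thesis unfolding S_def by (rule has_sum_infsum[OF has_sum_imp_summable])
  qed
  have Ps_deriv: "deriv (Ps j) \<tau> = (- \<tau>) ^ (m - j) * S" if "j \<le> m" for j
  proof -
    have "((\<lambda>Q. (- \<tau>) ^ (m - j) * (1 / q Q ^ k)) has_sum (deriv ^^ 1) (Ps j) \<tau>) I"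
      using Ps_sum[OF \<tau>B that, of 1]
      by (rule has_sum_cong[THEN iffD1, rotated]) (simp only: P_deriv)
    from has_sum_unique[OF this has_sum_cmult_right[OF S]] show ?thesis by simp
  qed
  have Hs_deriv: "(deriv ^^ (m + 1)) Hs \<tau> = - \<kappa> / (2 * \<i>) ^ m * fact m * S"
  proof -
    have "((\<lambda>Q. - \<kappa> / (2 * \<i>) ^ m * fact m * (1 / q Q ^ k)) has_sum (deriv ^^ (m + 1)) Hs \<tau>) I"
      using Hs_sum[OF \<tau>B, of "m + 1"]
      by (rule has_sum_cong[THEN iffD1, rotated]) (use H_deriv m_eq in simp)
    from has_sum_unique[OF this has_sum_cmult_right[OF S]] show ?thesis .
  qed

  define N where "N = real ((2 * k - 2) choose (k - 1)) * pi"
  define K where "K = complex_of_real (of_int D powr (1/2 - real k) / N)"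
  \<comment> \<open>Differentiation of a term produces D^(k - 1/2), which the normalising factor of
    the first series cancels.\<close>
  have powr_inv: "of_int D powr (1/2 - real k) * \<delta> ^ (2 * k - 1) = 1"
  proof -
    have "\<delta> ^ (2 * k - 1) = \<delta> powr real (2 * k - 1)"
      using D by (intro powr_realpow[symmetric]) (simp add: \<delta>_def)
    also have "\<dots> = of_int D powr (real k - 1/2)"
    proof -
      have "\<delta> = of_int D powr (1/2)" using D by (simp add: \<delta>_def powr_half_sqrt)
      then have "\<delta> powr real (2 * k - 1) = of_int D powr (1/2 * real (2 * k - 1))"
        by (simp only: powr_powr)
      also have "1/2 * real (2 * k - 1) = real k - 1/2" using k by (simp add: of_nat_diff)
      finally show ?thesis .
    qed
    finally show ?thesis using D by (simp flip: powr_add)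
  qed
  have f_series_eq: "of_real (of_int D powr (1/2 - real k)) * f_series k D \<tau> = 1 / of_real N * S"
  proof -
    have "of_int D powr (1/2 - real k) * (of_int D powr (real k - 1/2) / N) = 1 / N"
      using D by (simp flip: powr_add)
    then have "complex_of_real (of_int D powr (1/2 - real k)) * of_real (of_int D powr (real k - 1/2) / N) = 1 / of_real N"
      by (metis of_real_1 of_real_divide of_real_mult)
    moreover have "f_series k D \<tau> = of_real (of_int D powr (real k - 1/2) / N) * S"
      by (simp add: f_series_def N_def S_def I_def f_term_eq)
    ultimately show ?thesis by (simp only: mult.assoc[symmetric])
  qed
  have K\<delta>: "K * of_real (\<delta> ^ (2 * k - 1)) = 1 / of_real N"
    unfolding K_def of_real_mult[symmetric] times_divide_eq_left powr_inv by simp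

  let ?J = "{..m} <+> {()}"
  \<comment> \<open>The index \<open>Inl j\<close> carries the monomials in z paired with
    \<open>Ps j\<close>; the single index \<open>Inr ()\<close> carries the holomorphic part paired
    with 1.\<close>
  define f where "f = case_sum (\<lambda>j z. K * \<kappa> * C j * z ^ j) (\<lambda>_::unit. \<lambda>z. K * Hs z)"
  define g where "g = case_sum Ps (\<lambda>_::unit. \<lambda>_. 1)"
  have sum_J: "(\<Sum>j\<in>?J. h j) = (\<Sum>j\<le>m. h (Inl j)) + h (Inr ())" for h :: "nat + unit \<Rightarrow> complex"
    by (simp add: sum.Plus)
  have f_hol: "f j holomorphic_on B" if "j \<in> ?J" for j
    unfolding f_def by (auto split: sum.split intro!: holomorphic_intros Hs_hol)
  have g_hol: "g j holomorphic_on B" if "j \<in> ?J" for j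
    using that by (auto simp: g_def intro: Ps_hol)
  have F_series_eq: "F_series k D z = (\<Sum>j\<in>?J. f j z * cnj (g j z))" if "z \<in> B" for z
  proof -
    have "F_series k D z = K * infsum (F_term k D z) I"
      by (simp add: F_series_def K_def N_def I_def)
    then show ?thesis
      unfolding infsumI[OF F_sum[OF that]] sum_J
      by (simp add: f_def g_def distrib_left sum_distrib_left mult_ac add_ac)
  qed
  have D_op_eq: "(D_op ^^ n) (F_series k D) \<tau>
      = (1 / (2 * of_real pi * \<i>)) ^ n * (\<Sum>j\<in>?J. (deriv ^^ n) (f j) \<tau> * cnj (g j \<tau>))" for n
    by (rule D_op_funpow_sum_mult_cnj(1)[OF open_B f_hol g_hol F_series_eq \<tau>B])
  \<comment> \<open>The holomorphic part is paired with the constant 1 and contributes nothing. The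
    derivatives of the \<open>Ps j\<close> all contain \<open>S\<close>, and the binomial sum
    reassembles to (Im \<tau>)^m.\<close>
  have "wirtinger_bar (F_series k D) \<tau> = (\<Sum>j\<in>?J. f j \<tau> * cnj (deriv (g j) \<tau>))"
    by (rule wirtinger_sum_mult_cnj(3)[OF open_B \<tau>B f_hol g_hol F_series_eq])
  also have "\<dots> = K * \<kappa> * cnj S * (\<Sum>j\<le>m. C j * \<tau> ^ j * cnj ((- \<tau>) ^ (m - j)))"
    unfolding sum_J by (simp add: f_def g_def Ps_deriv sum_distrib_left mult_ac)
  also have "(\<Sum>j\<le>m. C j * \<tau> ^ j * cnj ((- \<tau>) ^ (m - j))) = ((\<tau> - cnj \<tau>) / (2 * \<i>)) ^ m"
    unfolding C_def power_diff_cnj_expand ..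
  also have "(\<tau> - cnj \<tau>) / (2 * \<i>) = of_real (Im \<tau>)"
    by (simp add: complex_eq_iff)
  finally have bar: "wirtinger_bar (F_series k D) \<tau> = K * \<kappa> * cnj S * of_real (Im \<tau>) ^ m" .
  have "xi_op (2 - 2 * int k) (F_series k D) \<tau>
      = 2 * \<i> * of_real (Im \<tau> powi (2 - 2 * int k) * Im \<tau> ^ m) * cnj (K * \<kappa>) * S"
    by (simp add: xi_op_def bar mult_ac)
  also have "Im \<tau> powi (2 - 2 * int k) * Im \<tau> ^ m = 1"
  proof -
    have "2 - 2 * int k = - int m" using k by (simp add: m_def of_nat_diff)
    then show ?thesis using Im_\<tau> by (simp add: power_int_minus)
  qed
  also have "2 * \<i> * of_real 1 * cnj (K * \<kappa>) * S = K * of_real (\<delta> ^ (2 * k - 1)) * S"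
  proof -
    have "cnj (K * \<kappa>) = - (K * \<kappa>)" by (simp add: K_def \<kappa>_def)
    then have "2 * \<i> * of_real 1 * cnj (K * \<kappa>) * S = K * - (2 * \<i> * \<kappa>) * S" by simp
    also have "- (2 * \<i> * \<kappa>) = of_real (\<delta> ^ (2 * k - 1))" by (simp add: \<kappa>_def)
    finally show ?thesis .
  qed
  finally have xi: "xi_op (2 - 2 * int k) (F_series k D) \<tau> =
      of_real (of_int D powr (1/2 - real k)) * f_series k D \<tau>"
    unfolding f_series_eq K\<delta> .

  \<comment> \<open>All \<open>Ps j\<close> vanish at \<tau>, so only the holomorphic part
    survives.\<close>
  have "(D_op ^^ (2 * k - 1)) (F_series k D) \<tau>
      = (1 / (2 * of_real pi * \<i>)) ^ (m + 1) * (deriv ^^ (m + 1)) (\<lambda>z. K * Hs z) \<tau>"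
    unfolding D_op_eq m_eq sum_J by (simp add: f_def g_def Ps\<tau> del: funpow.simps power_Suc)
  also have "(deriv ^^ (m + 1)) (\<lambda>z. K * Hs z) \<tau> = K * (deriv ^^ (m + 1)) Hs \<tau>"
    by (rule higher_deriv_cmult[OF Hs_hol \<tau>B open_B])
  also have "(1 / (2 * of_real pi * \<i>)) ^ (m + 1) * (K * (deriv ^^ (m + 1)) Hs \<tau>)
     = (K * of_real (\<delta> ^ (2 * k - 1))) * S * fact m * ((1 / (2 * of_real pi * \<i>)) ^ (m + 1) * (1 / (2 * \<i>)) ^ (m + 1))"
  proof -
    have "x * (1 / u) / u ^ m = x * (1 / u) ^ (m + 1)" for x u :: complex
      by (simp add: power_one_over)
    \<comment> \<open>Since - \<i> / 2 = 1 / (2 \<i>), the constant \<kappa> supplies the missing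
      power of 1 / (2 \<i>), one for each factor 1 / (2 \<pi> \<i>).\<close>
    moreover have "- \<kappa> = of_real (\<delta> ^ (2 * k - 1)) * (1 / (2 * \<i>))"
      by (simp add: \<kappa>_def)
    ultimately have "- \<kappa> / (2 * \<i>) ^ m = of_real (\<delta> ^ (2 * k - 1)) * (1 / (2 * \<i>)) ^ (m + 1)"
      by metis
    then show ?thesis unfolding Hs_deriv by (simp only: mult_ac)
  qed
  \<comment> \<open>Paired factors give - 1 / (4 \<pi>); the minus sign persists because m = 2 k - 2
    is even and m + 1 odd.\<close>
  also have "(1 / (2 * of_real pi * \<i>)) ^ (m + 1) * (1 / (2 * \<i>)) ^ (m + 1) = - 1 / of_real ((4 * pi) ^ (m + 1))"
  proof -
    have "(1 / (2 * of_real pi * \<i>)) * (1 / (2 * \<i>)) = - 1 / complex_of_real (4 * pi)"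
      by (simp add: field_simps)
    moreover have "(- 1 / complex_of_real (4 * pi)) ^ (m + 1) = - 1 / of_real ((4 * pi) ^ (m + 1))"
      unfolding power_divide by (simp add: m_def)
    ultimately show ?thesis by (simp only: power_mult_distrib[symmetric])
  qed
  also note K\<delta>
  finally have bol: "(D_op ^^ (2*k - 1)) (F_series k D) \<tau> =
      - of_real (fact (2*k - 2) / (4 * pi) ^ (2*k - 1)) * (1 / of_real N * S)"
    unfolding m_eq m_def[symmetric] by (simp add: mult_ac)
  show ?thesis
  proof (intro conjI allI impI)
    show "f_term k \<tau> summable_on forms_disc D"
      using has_sum_imp_summable[OF S] by (simp add: f_term_eq[abs_def] I_def)
    show "F_term k D \<tau> summable_on forms_disc D"
      using has_sum_imp_summable[OF F_sum[OF \<tau>B]] by (simp add: I_def)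
    show "(D_op ^^ j) (F_series k D) differentiable (at \<tau>)" for j
      by (rule D_op_funpow_sum_mult_cnj(2)[OF open_B f_hol g_hol F_series_eq \<tau>B])
    show "(D_op ^^ (2*k - 1)) (F_series k D) \<tau> =
      - of_real (fact (2*k - 2) / (4 * pi) ^ (2*k - 1) * of_int D powr (1/2 - real k)) *
      f_series k D \<tau>"
      unfolding bol f_series_eq[symmetric] by simp
  qed (rule xi)
qed

end
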